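(* Let $n\ge 0$ and $j\ge 1$ be integers with $j$ odd and $2^n j\ge 2$. Let $q\in k$ be a primitive $2^n j$-th root of unity and let $(a_{ij})\in\mathbb Z_{2^n j}^{2\times 2}$ be a parameter matrix of a generalised Taft algebra, with matrix of powers $(\mathfrak a_{ij})\in\mathbb N_0^{2\times 2}$ and matrix of coefficients $(\mu_{ij})\in\mathbb Z_{2^n}^{2\times 2}$. Let $\tau\in\mathbb N_0$ be the power of the coefficient matrix $(\mu_{ij})$. Then the following are equivalent: (1) the generalised Taft algebra $H_q(a_{ij})$ has no pair in involution; (2) $n\ge 1$; $\mu_{ij}\ne 0$ for all $1\le i,j\le 2$; $\mathfrak a_{11}+\mathfrak a_{22}<n$; $\mathfrak a_{11}\ne\mathfrak a_{21}$; and either $\tau>\min\{\mathfrak a_{ij}\mid 1\le i,j\le 2\}$ or $\det(\mu_{ij})=0$ modulo $2^n$.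
   Context: $k$ is an algebraically closed field of characteristic zero; $\mathbb Z_m=\mathbb Z/m\mathbb Z$. Pair in involution: for a Hopf algebra $H$ over $k$ with antipode $S$, a pair $(l,\beta)$ of a group-like element $l\in H$ and a group-like element $\beta$ of the finite dual $H^\circ$ (i.e. a character $\beta:H\to k$) with $S^2(h)=\beta(h_{(3)})\,\beta^{-1}(h_{(1)})\; l\,h_{(2)}\,l^{-1}$ for all $h\in H$ (Sweedler notation, $\beta^{-1}=\beta\circ S$). Parameter matrix: for $N\ge2$, a matrix $(a_{ij})\in\mathbb Z_N^{2\times2}$ with $a_{11}a_{12}\neq0$, $a_{21}a_{22}\ne0$, $a_{11}a_{22}+a_{12}a_{21}=0$ in $\mathbb Z_N$. Generalised Taft algebra $H_q(a_{ij})$: for $N\ge 2$, a parameter matrix $(a_{ij})\in\mathbb Z_N^{2\times 2}$ and a primitive $N$-th root of unity $q\in k$, let $N_x$ and $N_y$ be the additive orders of $a_{11}a_{12}$ and $a_{21}a_{22}$ in $\mathbb Z_N$. Then $H_q(a_{ij})$ is the Hopf algebra over $k$ generated by $g,x,y$ subject to $x^{N_x}=0$, $y^{N_y}=0$, $xy=q^{a_{11}a_{22}}yx$, $g^N=1$, $gx=q^{a_{12}}xg$, $gy=q^{a_{22}}yg$, with coproduct $\Delta(g)=g\otimes g$, $\Delta(x)=1\otimes x+x\otimes g^{a_{11}}$, $\Delta(y)=1\otimes y+y\otimes g^{a_{21}}$ and antipode $S(g)=g^{-1}$, $S(x)=-xg^{-a_{11}}$, $S(y)=-yg^{-a_{21}}$.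 Matrices of powers and coefficients: let $N=2^nj$ with $j$ odd and $(a_{ij})\in\mathbb Z_N^{2\times2}$ a parameter matrix. The matrix of powers $(\mathfrak a_{ij})\in\mathbb N_0^{2\times2}$ has as entries the minimal non-negative integers for which $2^{\mathfrak a_{ij}}\mu_{ij}=a_{ij}\bmod 2^n$ holds for some $\mu_{ij}\in\mathbb Z_{2^n}$ that is invertible or zero. A matrix $(\mu_{ij})\in\mathbb Z_{2^n}^{2\times2}$ of elements, each invertible or zero, satisfying these equations is called the matrix of coefficients (any choice is allowed). The power of the coefficient matrix is the minimal $\tau\in\mathbb N_0$ such that $2^\tau\nu=\det(\mu_{ij})$ modulo $2^n$ for some $\nu\in\mathbb Z_{2^n}$ that is invertible or zero. *)

theory Defs
  imports "HOL-Analysis.Analysis" "HOL-Library.Poly_Mapping" "HOL-Number_Theory.Cong"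
begin

section \<open>Tensor products\<close>

text \<open>
  \<^typ>\<open>'b \<Rightarrow>\<^sub>0 'k\<close> is the vector space with basis \<^typ>\<open>'b\<close>. The space \<open>V \<otimes> V\<close> is
  the quotient of the free vector space on \<open>V \<times> V\<close> by the subspace spanned by the
  bilinearity relations (likewise for three factors).
  An element of \<open>V \<otimes> V\<close> is represented, as in Sweedler notation, by a list of pairs
  \<open>[(a\<^sub>1, b\<^sub>1), \<dots>, (a\<^sub>r, b\<^sub>r)]\<close> standing for \<open>\<Sum>\<^sub>i a\<^sub>i \<otimes> b\<^sub>i\<close>; such lists are only ever
  compared modulo the bilinearity relations.
\<close>

definition pm_scale :: "'k::field \<Rightarrow> ('b \<Rightarrow>\<^sub>0 'k) \<Rightarrow> ('b \<Rightarrow>\<^sub>0 'k)" where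
  "pm_scale c f = Poly_Mapping.map ((*) c) f"

lemma lookup_pm_scale [simp]:
  "Poly_Mapping.lookup (pm_scale c f) b = c * Poly_Mapping.lookup f b"
  by (simp add: pm_scale_def map.rep_eq when_def)

interpretation free_vs: vector_space "pm_scale :: 'k::field \<Rightarrow> ('b \<Rightarrow>\<^sub>0 'k) \<Rightarrow> ('b \<Rightarrow>\<^sub>0 'k)"
  by unfold_locales (auto intro!: poly_mapping_eqI simp: lookup_add algebra_simps)

definition formal_sum :: "'b list \<Rightarrow> ('b \<Rightarrow>\<^sub>0 'k::field)" where
  "formal_sum ts = (\<Sum>t\<leftarrow>ts. Poly_Mapping.single t 1)"

definition bilinearity_relations ::
  "('k::field \<Rightarrow> 'v::ab_group_add \<Rightarrow> 'v) \<Rightarrow> ('v \<times> 'v \<Rightarrow>\<^sub>0 'k) set" where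
  "bilinearity_relations sc =
     {formal_sum [(a + a', b)] - formal_sum [(a, b), (a', b)] | a a' b. True}
   \<union> {formal_sum [(a, b + b')] - formal_sum [(a, b), (a, b')] | a b b'. True}
   \<union> {formal_sum [(sc c a, b)] - pm_scale c (formal_sum [(a, b)]) | c a b. True}
   \<union> {formal_sum [(a, sc c b)] - pm_scale c (formal_sum [(a, b)]) | c a b. True}"

definition trilinearity_relations ::
  "('k::field \<Rightarrow> 'v::ab_group_add \<Rightarrow> 'v) \<Rightarrow> ('v \<times> 'v \<times> 'v \<Rightarrow>\<^sub>0 'k) set" where
  "trilinearity_relations sc =
     {formal_sum [(a + a', b, c)] - formal_sum [(a, b, c), (a', b, c)] | a a' b c. True}
   \<union> {formal_sum [(a, b + b', c)] - formal_sum [(a, b, c), (a, b', c)] | a b b' c. True}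
   \<union> {formal_sum [(a, b, c + c')] - formal_sum [(a, b, c), (a, b, c')] | a b c c'. True}
   \<union> {formal_sum [(sc r a, b, c)] - pm_scale r (formal_sum [(a, b, c)]) | r a b c. True}
   \<union> {formal_sum [(a, sc r b, c)] - pm_scale r (formal_sum [(a, b, c)]) | r a b c. True}
   \<union> {formal_sum [(a, b, sc r c)] - pm_scale r (formal_sum [(a, b, c)]) | r a b c. True}"

definition tensor_eq ::
  "('k::field \<Rightarrow> 'v::ab_group_add \<Rightarrow> 'v) \<Rightarrow> ('v \<times> 'v) list \<Rightarrow> ('v \<times> 'v) list \<Rightarrow> bool" where
  "tensor_eq sc s t \<longleftrightarrow>
     formal_sum s - formal_sum t \<in> free_vs.span (bilinearity_relations sc)"

definition tensor3_eq ::
  "('k::field \<Rightarrow> 'v::ab_group_add \<Rightarrow> 'v) \<Rightarrow> ('v \<times> 'v \<times> 'v) list \<Rightarrow> ('v \<times> 'v \<times> 'v) list \<Rightarrow> bool" where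
  "tensor3_eq sc s t \<longleftrightarrow>
     formal_sum s - formal_sum t \<in> free_vs.span (trilinearity_relations sc)"

definition tensor_mult :: "('h::ring_1 \<times> 'h) list \<Rightarrow> ('h \<times> 'h) list \<Rightarrow> ('h \<times> 'h) list" where
  "tensor_mult s t = [(a * c, b * d). (a, b) \<leftarrow> s, (c, d) \<leftarrow> t]"


section \<open>Hopf algebras and pairs in involution\<close>

text \<open>
  \<open>\<Delta> h\<close> is some representative of the coproduct of \<open>h\<close>; all axioms on \<open>\<Delta>\<close> are imposed
  modulo \<^const>\<open>tensor_eq\<close> resp. \<^const>\<open>tensor3_eq\<close>.
\<close>

locale hopf_algebra = vector_space sc
  for sc :: "'k::field \<Rightarrow> 'h::ring_1 \<Rightarrow> 'h" +
  fixes \<Delta> :: "'h \<Rightarrow> ('h \<times> 'h) list"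
    and \<epsilon> :: "'h \<Rightarrow> 'k"
    and S :: "'h \<Rightarrow> 'h"
  assumes scale_mult_left: "sc c a * b = sc c (a * b)"
    and scale_mult_right: "a * sc c b = sc c (a * b)"
    and comult_add: "tensor_eq sc (\<Delta> (a + b)) (\<Delta> a @ \<Delta> b)"
    and comult_scale: "tensor_eq sc (\<Delta> (sc c a)) [(sc c a1, a2). (a1, a2) \<leftarrow> \<Delta> a]"
    and comult_one: "tensor_eq sc (\<Delta> 1) [(1, 1)]"
    and comult_mult: "tensor_eq sc (\<Delta> (a * b)) (tensor_mult (\<Delta> a) (\<Delta> b))"
    and coassoc: "tensor3_eq sc
          [(a11, a12, a2). (a1, a2) \<leftarrow> \<Delta> a, (a11, a12) \<leftarrow> \<Delta> a1]
          [(a1, a21, a22). (a1, a2) \<leftarrow> \<Delta> a, (a21, a22) \<leftarrow> \<Delta> a2]"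
    and counit_linear: "Vector_Spaces.linear sc (*) \<epsilon>"
    and counit_one: "\<epsilon> 1 = 1"
    and counit_mult: "\<epsilon> (a * b) = \<epsilon> a * \<epsilon> b"
    and counit_left: "(\<Sum>(a1, a2)\<leftarrow>\<Delta> a. sc (\<epsilon> a1) a2) = a"
    and counit_right: "(\<Sum>(a1, a2)\<leftarrow>\<Delta> a. sc (\<epsilon> a2) a1) = a"
    and antipode_linear: "Vector_Spaces.linear sc sc S"
    and antipode_left: "(\<Sum>(a1, a2)\<leftarrow>\<Delta> a. S a1 * a2) = sc (\<epsilon> a) 1"
    and antipode_right: "(\<Sum>(a1, a2)\<leftarrow>\<Delta> a. a1 * S a2) = sc (\<epsilon> a) 1"

definition grouplike ::
  "('k::field \<Rightarrow> 'h::ring_1 \<Rightarrow> 'h) \<Rightarrow> ('h \<Rightarrow> ('h \<times> 'h) list) \<Rightarrow> ('h \<Rightarrow> 'k) \<Rightarrow> 'h \<Rightarrow> bool" where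
  "grouplike sc \<Delta> \<epsilon> l \<longleftrightarrow> tensor_eq sc (\<Delta> l) [(l, l)] \<and> \<epsilon> l = 1"

text \<open>The group-like elements of the finite dual are the characters.\<close>

definition algebra_character ::
  "('k::field \<Rightarrow> 'h::ring_1 \<Rightarrow> 'h) \<Rightarrow> ('h \<Rightarrow> 'k) \<Rightarrow> bool" where
  "algebra_character sc \<beta> \<longleftrightarrow>
     Vector_Spaces.linear sc (*) \<beta> \<and> \<beta> 1 = 1 \<and> (\<forall>a b. \<beta> (a * b) = \<beta> a * \<beta> b)"

definition comult2 :: "('h \<Rightarrow> ('h \<times> 'h) list) \<Rightarrow> 'h \<Rightarrow> ('h \<times> 'h \<times> 'h) list" where
  "comult2 \<Delta> h = [(h1, h2, h3). (h', h3) \<leftarrow> \<Delta> h, (h1, h2) \<leftarrow> \<Delta> h']"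

text \<open>The witness \<open>l'\<close> below is the (unique) inverse of \<open>l\<close>, and \<open>\<beta>\<inverse> = \<beta> \<circ> S\<close>.\<close>

definition pair_in_involution ::
  "('k::field \<Rightarrow> 'h::ring_1 \<Rightarrow> 'h) \<Rightarrow> ('h \<Rightarrow> ('h \<times> 'h) list) \<Rightarrow> ('h \<Rightarrow> 'k) \<Rightarrow> ('h \<Rightarrow> 'h) \<Rightarrow>
    'h \<Rightarrow> ('h \<Rightarrow> 'k) \<Rightarrow> bool" where
  "pair_in_involution sc \<Delta> \<epsilon> S l \<beta> \<longleftrightarrow>
     grouplike sc \<Delta> \<epsilon> l \<and> algebra_character sc \<beta> \<and>
     (\<exists>l'. l * l' = 1 \<and> l' * l = 1 \<and>
       (\<forall>h. S (S h) =
          (\<Sum>(h1, h2, h3)\<leftarrow>comult2 \<Delta> h. sc (\<beta> h3 * \<beta> (S h1)) (l * h2 * l'))))"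


section \<open>Free algebras and presentations\<close>

text \<open>
  Words over an alphabet, with concatenation written additively, so that the convolution
  product on \<open>'x word \<Rightarrow>\<^sub>0 'k\<close> is that of the free algebra on the alphabet.
\<close>

datatype 'x word = Word (letters: "'x list")

instantiation word :: (type) monoid_add
begin

definition zero_word :: "'x word" where "zero_word = Word []"

definition plus_word :: "'x word \<Rightarrow> 'x word \<Rightarrow> 'x word" where
  "plus_word u v = Word (letters u @ letters v)"

instance
  by standard (simp_all add: zero_word_def plus_word_def)

end

type_synonym ('x, 'k) free_algebra = "'x word \<Rightarrow>\<^sub>0 'k"

definition free_gen :: "'x \<Rightarrow> ('x, 'k::field) free_algebra" where
  "free_gen i = Poly_Mapping.single (Word [i]) 1"

definition free_const :: "'k::field \<Rightarrow> ('x, 'k) free_algebra" where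
  "free_const c = Poly_Mapping.single 0 c"

definition free_eval ::
  "('k::field \<Rightarrow> 'h::ring_1 \<Rightarrow> 'h) \<Rightarrow> ('x \<Rightarrow> 'h) \<Rightarrow> ('x, 'k) free_algebra \<Rightarrow> 'h" where
  "free_eval sc v f =
     (\<Sum>w\<in>Poly_Mapping.keys f. sc (Poly_Mapping.lookup f w) (prod_list (map v (letters w))))"

inductive_set two_sided_ideal :: "'r::ring_1 set \<Rightarrow> 'r set" for R where
  zero: "0 \<in> two_sided_ideal R"
| step: "u \<in> two_sided_ideal R \<Longrightarrow> r \<in> R \<Longrightarrow> u + a * r * b \<in> two_sided_ideal R"

text \<open>
  The algebra \<^typ>\<open>'h\<close> is generated by the elements \<open>v i\<close> subject to the relations \<open>r = 0\<close>
  for \<open>r \<in> R\<close>: the canonical map from the free algebra is onto, with kernel the two-sided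
  ideal generated by \<open>R\<close>.
\<close>

definition presented_by ::
  "('k::field \<Rightarrow> 'h::ring_1 \<Rightarrow> 'h) \<Rightarrow> ('x \<Rightarrow> 'h) \<Rightarrow> ('x, 'k) free_algebra set \<Rightarrow> bool" where
  "presented_by sc v R \<longleftrightarrow>
     range (free_eval sc v) = UNIV \<and> {f. free_eval sc v f = 0} = two_sided_ideal R"


section \<open>Generalised Taft algebras\<close>

text \<open>
  Elements of \<open>\<int>/m\<int>\<close> are represented by arbitrary integer representatives; all notions below
  depend on the residue classes only. A matrix \<open>(a\<^sub>i\<^sub>j)\<close> is \<^term>\<open>a :: int^2^2\<close> with
  entries \<^term>\<open>a $ i $ j\<close>.
\<close>

definition additive_order_mod :: "nat \<Rightarrow> int \<Rightarrow> nat" where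
  "additive_order_mod m c = (LEAST d. 0 < d \<and> [int d * c = 0] (mod int m))"

definition primitive_root_of_unity :: "nat \<Rightarrow> 'k::field \<Rightarrow> bool" where
  "primitive_root_of_unity m q \<longleftrightarrow> 0 < m \<and> q ^ m = 1 \<and> (\<forall>d. 0 < d \<and> d < m \<longrightarrow> q ^ d \<noteq> 1)"

definition parameter_matrix :: "nat \<Rightarrow> int^2^2 \<Rightarrow> bool" where
  "parameter_matrix N a \<longleftrightarrow> N \<ge> 2 \<and>
     \<not> [a$1$1 * a$1$2 = 0] (mod int N) \<and> \<not> [a$2$1 * a$2$2 = 0] (mod int N) \<and>
     [a$1$1 * a$2$2 + a$1$2 * a$2$1 = 0] (mod int N)"

text \<open>\<open>g\<^sup>c\<close> for a residue class \<open>c\<close> modulo \<open>N\<close>, where \<open>g\<^sup>N = 1\<close>; in particular \<open>g\<close> to the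
  power \<open>-c\<close> is the inverse of \<open>g\<^sup>c\<close>.\<close>

definition power_mod :: "nat \<Rightarrow> 'h::monoid_mult \<Rightarrow> int \<Rightarrow> 'h" where
  "power_mod N g c = g ^ nat (c mod int N)"

datatype taft_generator = Gen_g | Gen_x | Gen_y

definition taft_relations ::
  "nat \<Rightarrow> 'k::field \<Rightarrow> int^2^2 \<Rightarrow> (taft_generator, 'k) free_algebra set" where
  "taft_relations N q a =
     (let g = free_gen Gen_g; x = free_gen Gen_x; y = free_gen Gen_y;
          Nx = additive_order_mod N (a$1$1 * a$1$2);
          Ny = additive_order_mod N (a$2$1 * a$2$2)
      in {x ^ Nx,
          y ^ Ny,
          x * y - free_const (q powi (a$1$1 * a$2$2)) * y * x,
          g ^ N - 1,
          g * x - free_const (q powi (a$1$2)) * x * g,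
          g * y - free_const (q powi (a$2$2)) * y * g})"

text \<open>
  \<open>H\<^sub>q(a\<^sub>i\<^sub>j)\<close>, as a Hopf algebra on the type \<^typ>\<open>'h\<close> with distinguished generators
  \<open>g, x, y\<close>. This determines the Hopf algebra up to unique isomorphism preserving the
  generators; in particular the counit is forced by the coproduct.
\<close>

locale generalised_taft_algebra = hopf_algebra sc \<Delta> \<epsilon> S
  for N :: nat
    and q :: "'k::field"
    and a :: "int^2^2"
    and sc :: "'k \<Rightarrow> 'h::ring_1 \<Rightarrow> 'h"
    and \<Delta> :: "'h \<Rightarrow> ('h \<times> 'h) list"
    and \<epsilon> :: "'h \<Rightarrow> 'k"
    and S :: "'h \<Rightarrow> 'h"
    and g x y :: 'h +
  assumes parameter_matrix: "parameter_matrix N a"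
    and primitive_root: "primitive_root_of_unity N q"
    and presentation:
      "presented_by sc (case_taft_generator g x y) (taft_relations N q a)"
    and comult_g: "tensor_eq sc (\<Delta> g) [(g, g)]"
    and comult_x: "tensor_eq sc (\<Delta> x) [(1, x), (x, power_mod N g (a$1$1))]"
    and comult_y: "tensor_eq sc (\<Delta> y) [(1, y), (y, power_mod N g (a$2$1))]"
    and antipode_g: "S g = power_mod N g (-1)"
    and antipode_x: "S x = - (x * power_mod N g (- (a$1$1)))"
    and antipode_y: "S y = - (y * power_mod N g (- (a$2$1)))"


section \<open>Matrices of powers and of coefficients\<close>

definition invertible_or_zero_mod :: "nat \<Rightarrow> int \<Rightarrow> bool" where
  "invertible_or_zero_mod m c \<longleftrightarrow>
     (\<exists>d. [c * d = 1] (mod int m)) \<or> [c = 0] (mod int m)"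

text \<open>The minimal \<open>s\<close> such that \<open>2\<^sup>s \<nu> = c\<close> modulo \<open>2\<^sup>n\<close> for some \<open>\<nu>\<close> that is invertible or
  zero modulo \<open>2\<^sup>n\<close>; it is \<open>0\<close> if \<open>c = 0\<close> modulo \<open>2\<^sup>n\<close>.\<close>

definition two_power_mod :: "nat \<Rightarrow> int \<Rightarrow> nat" where
  "two_power_mod n c =
     (LEAST s. \<exists>\<nu>. invertible_or_zero_mod (2 ^ n) \<nu> \<and> [2 ^ s * \<nu> = c] (mod 2 ^ n))"

definition matrix_of_powers :: "nat \<Rightarrow> int^2^2 \<Rightarrow> nat^2^2" where
  "matrix_of_powers n a = (\<chi> i j. two_power_mod n (a$i$j))"

definition is_matrix_of_coefficients :: "nat \<Rightarrow> int^2^2 \<Rightarrow> int^2^2 \<Rightarrow> bool" where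
  "is_matrix_of_coefficients n a \<mu> \<longleftrightarrow>
     (\<forall>i j. invertible_or_zero_mod (2 ^ n) (\<mu>$i$j) \<and>
        [2 ^ (matrix_of_powers n a $ i $ j) * \<mu>$i$j = a$i$j] (mod 2 ^ n))"

definition coefficient_matrix_power :: "nat \<Rightarrow> int^2^2 \<Rightarrow> nat" where
  "coefficient_matrix_power n \<mu> = two_power_mod n (det \<mu>)"

end

theory Submission
  imports Defs
begin

text \<open>
  Write \<open>N = 2\<^sup>n j\<close> and \<open>H = H\<^sub>q(a\<^sub>i\<^sub>j)\<close>. The proof turns the existence of a pair in involution
  into a system of two linear congruences modulo \<open>N\<close> and then solves that system.

  Let \<open>(l, \<beta>)\<close> consist of a group-like element and a character. Both \<open>S\<^sup>2\<close> and the twisted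
  conjugation \<open>h \<mapsto> \<beta>(h\<^sub>3) \<beta>(S h\<^sub>1) l h\<^sub>2 l\<^sup>-\<^sup>1\<close> are algebra endomorphisms of \<open>H\<close>, so they agree as
  soon as they agree on \<open>g\<close>, \<open>x\<close> and \<open>y\<close>. A character kills the nilpotent elements \<open>x\<close> and \<open>y\<close>
  and sends \<open>g\<close> to some \<open>q\<^sup>e\<close>. One has \<open>S\<^sup>2(x) = q\<^sup>c x\<close> with \<open>c = a\<^sub>1\<^sub>1 a\<^sub>1\<^sub>2\<close>, while the twist by
  \<open>\<beta>\<close> multiplies \<open>x\<close> by \<open>q\<close> to the power \<open>e a\<^sub>1\<^sub>1\<close>, and conjugation by \<open>g\<^sup>d\<close> multiplies it by \<open>q\<close>
  to the power \<open>d a\<^sub>1\<^sub>2\<close>; likewise for \<open>y\<close>. Hence (\<open>pair_in_involution_exists_iff\<close>) a pair in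
  involution exists if and only if the system
    \<open>e a\<^sub>1\<^sub>1 + d a\<^sub>1\<^sub>2 = a\<^sub>1\<^sub>1 a\<^sub>1\<^sub>2\<close>,  \<open>e a\<^sub>2\<^sub>1 + d a\<^sub>2\<^sub>2 = a\<^sub>2\<^sub>1 a\<^sub>2\<^sub>2\<close>
  has a solution \<open>(e, d)\<close> modulo \<open>N\<close>. That every group-like \<open>l\<close>, and not just a power of \<open>g\<close>,
  leads to this system is seen without a classification of group-like elements: the values at \<open>l\<close>
  of the characters of \<open>H\<close> are multiplicative under convolution, so there is a \<open>d\<close> such that the
  character with \<open>g \<mapsto> q\<^sup>e\<close> has the value \<open>q\<close> to the power \<open>d e\<close> at \<open>l\<close> (\<open>grouplike_character_values\<close>),
  and a two-dimensional representation of \<open>H\<close> by lower triangular matrices, in which \<open>x\<close> is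
  the off-diagonal matrix unit, compares \<open>l x l\<^sup>-\<^sup>1\<close> with \<open>x\<close> (\<open>skew_generator_conjugation_weight\<close>).

  By the Chinese remainder theorem the system may be treated modulo \<open>j\<close> and modulo \<open>2\<^sup>n\<close>
  separately. Modulo the odd number \<open>j\<close> it is solved by \<open>e = (a\<^sub>1\<^sub>2 + a\<^sub>2\<^sub>2)/2\<close> and
  \<open>d = (a\<^sub>1\<^sub>1 + a\<^sub>2\<^sub>1)/2\<close> because of the relation \<open>a\<^sub>1\<^sub>1 a\<^sub>2\<^sub>2 + a\<^sub>1\<^sub>2 a\<^sub>2\<^sub>1 = 0\<close>. Modulo \<open>2\<^sup>n\<close> it is also
  solvable if both products in this relation vanish, with \<open>e = a\<^sub>1\<^sub>2 + a\<^sub>2\<^sub>2\<close> and \<open>d = 0\<close>; this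
  covers the cases of a vanishing entry and of \<open>\<aa>\<^sub>1\<^sub>1 + \<aa>\<^sub>2\<^sub>2 \<ge> n\<close>. Otherwise all \<open>\<mu>\<^sub>i\<^sub>j\<close> are odd and
  \<open>\<aa>\<^sub>1\<^sub>1 + \<aa>\<^sub>2\<^sub>2 = \<aa>\<^sub>1\<^sub>2 + \<aa>\<^sub>2\<^sub>1\<close>. Eliminating the unknown whose coefficient has the smallest
  2-adic valuation leaves one congruence
    \<open>det \<mu> \<cdot> f = \<mu>\<^sub>1\<^sub>1 \<mu>\<^sub>2\<^sub>2 (a\<^sub>2\<^sub>1 + a\<^sub>1\<^sub>1)\<close>
  for \<open>f = d\<close>, if that coefficient is \<open>a\<^sub>1\<^sub>1\<close>, to a modulus that is divisible by 2 to the power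
  \<open>\<aa>\<^sub>1\<^sub>1 + 1\<close>. Comparing the 2-adic valuations of \<open>det \<mu>\<close> and of the right-hand side, which is
  exactly the minimum of the \<open>\<aa>\<^sub>i\<^sub>j\<close> unless \<open>\<aa>\<^sub>1\<^sub>1 = \<aa>\<^sub>2\<^sub>1\<close>, gives the criterion
  (\<open>solvable_mod_pow2_core\<close>, \<open>unsolvable_mod_pow2_iff\<close>).
\<close>

section \<open>Linear extension from a basis\<close>

text \<open>
  Evaluation of tensors and evaluation of noncommutative polynomials are both instances of
  the linear map on a free vector space that is prescribed by its values on the basis.
\<close>

definition linear_extension ::
  "('k::field \<Rightarrow> 'v \<Rightarrow> 'v) \<Rightarrow> ('b \<Rightarrow> 'v::ab_group_add) \<Rightarrow> ('b \<Rightarrow>\<^sub>0 'k) \<Rightarrow> 'v" where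
  "linear_extension sc h F = (\<Sum>p\<in>Poly_Mapping.keys F. sc (Poly_Mapping.lookup F p) (h p))"

context vector_space
begin

lemma linear_extension_superset:
  assumes "finite A" "Poly_Mapping.keys F \<subseteq> A"
  shows "linear_extension scale h F = (\<Sum>p\<in>A. scale (Poly_Mapping.lookup F p) (h p))"
  unfolding linear_extension_def
  by (rule sum.mono_neutral_left[OF assms]) (auto simp: in_keys_iff)

lemma linear_extension_zero [simp]: "linear_extension scale h 0 = 0"
  by (simp add: linear_extension_def)

lemma linear_extension_single [simp]:
  "linear_extension scale h (Poly_Mapping.single p c) = scale c (h p)"
  by (simp add: linear_extension_def)

lemma linear_extension_add:
  "linear_extension scale h (F + G) = linear_extension scale h F + linear_extension scale h G"
proof -
  let ?A = "Poly_Mapping.keys F \<union> Poly_Mapping.keys G"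
  have "linear_extension scale h (F + G) =
      (\<Sum>p\<in>?A. scale (Poly_Mapping.lookup (F + G) p) (h p))"
    by (rule linear_extension_superset) (auto simp: keys_add)
  also have "\<dots> = (\<Sum>p\<in>?A. scale (Poly_Mapping.lookup F p) (h p)) +
      (\<Sum>p\<in>?A. scale (Poly_Mapping.lookup G p) (h p))"
    by (simp add: lookup_add scale_left_distrib sum.distrib)
  also have "\<dots> = linear_extension scale h F + linear_extension scale h G"
    by (simp add: linear_extension_superset[of ?A])
  finally show ?thesis .
qed

lemma linear_extension_scale:
  "linear_extension scale h (pm_scale c F) = scale c (linear_extension scale h F)"
proof -
  have "linear_extension scale h (pm_scale c F) =
      (\<Sum>p\<in>Poly_Mapping.keys F. scale (Poly_Mapping.lookup (pm_scale c F) p) (h p))"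
    by (rule linear_extension_superset) (auto simp: in_keys_iff)
  then show ?thesis
    by (simp add: linear_extension_def scale_sum_right)
qed

lemma linear_extension_minus: "linear_extension scale h (- F) = - linear_extension scale h F"
  using linear_extension_add[of h F "- F"] by (simp add: eq_neg_iff_add_eq_0 add.commute)

lemma linear_extension_diff:
  "linear_extension scale h (F - G) = linear_extension scale h F - linear_extension scale h G"
  using linear_extension_add[of h F "- G"] by (simp add: linear_extension_minus)

lemma linear_extension_sum:
  "linear_extension scale h (\<Sum>i\<in>I. F i) = (\<Sum>i\<in>I. linear_extension scale h (F i))"
  by (induction I rule: infinite_finite_induct) (simp_all add: linear_extension_add)

lemma linear_extension_formal_sum:
  "linear_extension scale h (formal_sum ts) = (\<Sum>t\<leftarrow>ts. h t)"
  by (induction ts) (simp_all add: formal_sum_def linear_extension_add)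

text \<open>
  This is how maps descend to quotients: a linear extension that kills the relations kills
  everything that is identified with zero.
\<close>

lemma linear_extension_span:
  assumes "X \<in> free_vs.span R" and "\<And>r. r \<in> R \<Longrightarrow> linear_extension scale h r = 0"
  shows "linear_extension scale h X = 0"
  using assms(1)
  by (induction rule: free_vs.span_induct_alt)
    (simp_all add: linear_extension_add linear_extension_scale assms(2))

end

lemma poly_mapping_as_sum_of_monomials:
  "F = (\<Sum>p\<in>Poly_Mapping.keys F. Poly_Mapping.single p (Poly_Mapping.lookup F p))"
  by (intro poly_mapping_eqI)
    (auto simp: lookup_sum lookup_single when_def in_keys_iff sum.delta' if_distrib cong: if_cong)

section \<open>Evaluating tensors\<close>

text \<open>
  The sum of the values of a bilinear map depends only on the class in the tensor product, so a
  Sweedler sum may be computed on any representative of the coproduct.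
\<close>

lemma tensor_eq_bilinear:
  assumes eq: "tensor_eq sc s t"
    and left: "\<And>b. Vector_Spaces.linear sc sc' (\<lambda>a. B a b)"
    and right: "\<And>a. Vector_Spaces.linear sc sc' (B a)"
  shows "(\<Sum>(a, b)\<leftarrow>s. B a b) = (\<Sum>(a, b)\<leftarrow>t. B a b)"
proof -
  interpret V: vector_space sc' using right unfolding Vector_Spaces.linear_iff by blast
  let ?E = "linear_extension sc' (\<lambda>(a, b). B a b)"
  have B: "B (a + a') b = B a b + B a' b" "B a (b + b') = B a b + B a b'"
    "B (sc c a) b = sc' c (B a b)" "B a (sc c b) = sc' c (B a b)" for a a' b b' c
    using left[of b] right[of a] unfolding Vector_Spaces.linear_iff by blast+
  have "?E (formal_sum s - formal_sum t) = 0"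
  proof (rule V.linear_extension_span)
    show "formal_sum s - formal_sum t \<in> free_vs.span (bilinearity_relations sc)"
      using eq by (simp add: tensor_eq_def)
  qed (auto simp: bilinearity_relations_def V.linear_extension_diff V.linear_extension_scale
        V.linear_extension_formal_sum B)
  then show ?thesis
    by (simp add: V.linear_extension_diff V.linear_extension_formal_sum)
qed

lemma tensor3_eq_trilinear:
  assumes eq: "tensor3_eq sc s t"
    and first: "\<And>b c. Vector_Spaces.linear sc sc' (\<lambda>a. B a b c)"
    and second: "\<And>a c. Vector_Spaces.linear sc sc' (\<lambda>b. B a b c)"
    and third: "\<And>a b. Vector_Spaces.linear sc sc' (B a b)"
  shows "(\<Sum>(a, b, c)\<leftarrow>s. B a b c) = (\<Sum>(a, b, c)\<leftarrow>t. B a b c)"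
proof -
  interpret V: vector_space sc' using third unfolding Vector_Spaces.linear_iff by blast
  let ?E = "linear_extension sc' (\<lambda>(a, b, c). B a b c)"
  have B: "B (a + a') b c = B a b c + B a' b c" "B a (b + b') c = B a b c + B a b' c"
    "B a b (c + c') = B a b c + B a b c'"
    "B (sc r a) b c = sc' r (B a b c)" "B a (sc r b) c = sc' r (B a b c)"
    "B a b (sc r c) = sc' r (B a b c)" for a a' b b' c c' r
    using first[of b c] second[of a c] third[of a b] unfolding Vector_Spaces.linear_iff by blast+
  have "?E (formal_sum s - formal_sum t) = 0"
  proof (rule V.linear_extension_span)
    show "formal_sum s - formal_sum t \<in> free_vs.span (trilinearity_relations sc)"
      using eq by (simp add: tensor3_eq_def)
  qed (auto simp: trilinearity_relations_def V.linear_extension_diff V.linear_extension_scale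
        V.linear_extension_formal_sum B)
  then show ?thesis
    by (simp add: V.linear_extension_diff V.linear_extension_formal_sum)
qed

section \<open>Free algebras\<close>

locale algebra_over_field = vector_space sc for sc :: "'k::field \<Rightarrow> 'h::ring_1 \<Rightarrow> 'h" +
  assumes scale_mult: "sc c a * b = sc c (a * b)" "a * sc c b = sc c (a * b)"
begin

lemma free_eval_linear_extension:
  "free_eval sc v = linear_extension sc (\<lambda>w. prod_list (map v (letters w)))"
  by (simp add: fun_eq_iff free_eval_def linear_extension_def)

lemma free_eval_mult: "free_eval sc v (F * G) = free_eval sc v F * free_eval sc v G"
proof -
  let ?m = "\<lambda>w. prod_list (map v (letters w))"
  have "F * G = (\<Sum>p\<in>Poly_Mapping.keys F. \<Sum>r\<in>Poly_Mapping.keys G.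
      Poly_Mapping.single (p + r) (Poly_Mapping.lookup F p * Poly_Mapping.lookup G r))"
    by (subst poly_mapping_as_sum_of_monomials[of F], subst poly_mapping_as_sum_of_monomials[of G])
      (simp add: sum_product mult_single)
  then have "free_eval sc v (F * G) = (\<Sum>p\<in>Poly_Mapping.keys F. \<Sum>r\<in>Poly_Mapping.keys G.
      sc (Poly_Mapping.lookup F p * Poly_Mapping.lookup G r) (?m p * ?m r))"
    by (simp add: free_eval_linear_extension linear_extension_sum plus_word_def)
  also have "\<dots> = free_eval sc v F * free_eval sc v G"
    by (simp add: free_eval_linear_extension linear_extension_def sum_product
        scale_mult mult.commute)
  finally show ?thesis .
qed

lemma free_eval_simps [simp]:
  "free_eval sc v 0 = 0"
  "free_eval sc v 1 = 1"
  "free_eval sc v (F + G) = free_eval sc v F + free_eval sc v G"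
  "free_eval sc v (F - G) = free_eval sc v F - free_eval sc v G"
  "free_eval sc v (pm_scale c F) = sc c (free_eval sc v F)"
  "free_eval sc v (F * G) = free_eval sc v F * free_eval sc v G"
  "free_eval sc v (free_gen i) = v i"
  "free_eval sc v (free_const c) = sc c 1"
proof -
  show "free_eval sc v 1 = 1"
    unfolding free_eval_linear_extension single_one[symmetric] linear_extension_single
    by (simp add: zero_word_def)
qed (simp_all add: free_eval_mult, simp_all add: free_eval_linear_extension linear_extension_add 
    linear_extension_diff linear_extension_scale free_gen_def free_const_def zero_word_def)

lemma free_eval_power [simp]: "free_eval sc v (F ^ m) = free_eval sc v F ^ m"
  by (induction m) simp_all

lemma free_eval_two_sided_ideal:
  assumes "F \<in> two_sided_ideal R" and "\<And>r. r \<in> R \<Longrightarrow> free_eval sc v r = 0"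
  shows "free_eval sc v F = 0"
  using assms(1) by induction (simp_all add: assms(2))

lemma presented_by_relation:
  assumes "presented_by sc v R" "r \<in> R"
  shows "free_eval sc v r = 0"
proof -
  have "0 + 1 * r * 1 \<in> two_sided_ideal R"
    by (intro two_sided_ideal.intros assms)
  then show ?thesis
    using assms(1) by (auto simp: presented_by_def)
qed

end

text \<open>
  The universal property of an algebra given by generators and relations. Characters and
  two-dimensional representations of the Taft algebra are obtained from it.
\<close>

lemma presented_by_universal:
  assumes "algebra_over_field sc" "algebra_over_field sc'"
    and pres: "presented_by sc v R"
    and rel: "\<And>r. r \<in> R \<Longrightarrow> free_eval sc' v' r = 0"
  obtains \<phi> where "Vector_Spaces.linear sc sc' \<phi>" "\<phi> 1 = 1" "\<And>a b. \<phi> (a * b) = \<phi> a * \<phi> b"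
    "\<And>i. \<phi> (v i) = v' i"
proof -
  interpret H: algebra_over_field sc by fact
  interpret K: algebra_over_field sc' by fact
  have well_defined: "free_eval sc' v' F = free_eval sc' v' G"
    if "free_eval sc v F = free_eval sc v G" for F G
  proof -
    have "free_eval sc v (F - G) = 0" using that by simp
    then have "F - G \<in> two_sided_ideal R" using pres by (auto simp: presented_by_def)
    then have "free_eval sc' v' (F - G) = 0" by (rule K.free_eval_two_sided_ideal) (rule rel)
    then show ?thesis by simp
  qed
  have onto: "\<exists>F. free_eval sc v F = a" for a
    using pres unfolding presented_by_def by (metis UNIV_I imageE)
  \<comment> \<open>any preimage in the free algebra will do, since two of them differ by an element of the ideal\<close>
  define \<phi> where "\<phi> a = free_eval sc' v' (SOME F. free_eval sc v F = a)" for a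
  have \<phi>: "\<phi> (free_eval sc v F) = free_eval sc' v' F" for F
    unfolding \<phi>_def by (rule well_defined) (rule someI_ex, blast)
  show thesis
  proof (rule that[of \<phi>])
    show "Vector_Spaces.linear sc sc' \<phi>"
      unfolding Vector_Spaces.linear_iff
    proof (intro conjI allI)
      fix a b c
      obtain F G where FG: "a = free_eval sc v F" "b = free_eval sc v G" using onto by metis
      show "\<phi> (a + b) = \<phi> a + \<phi> b"
        using \<phi>[of "F + G"] by (simp add: \<phi> FG)
      show "\<phi> (sc c a) = sc' c (\<phi> a)"
        using \<phi>[of "pm_scale c F"] by (simp add: \<phi> FG)
    qed unfold_locales
    show "\<phi> 1 = 1" using \<phi>[of 1] by simp
    show "\<phi> (a * b) = \<phi> a * \<phi> b" for a b
    proof -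
      obtain F G where FG: "a = free_eval sc v F" "b = free_eval sc v G" using onto by metis
      show ?thesis using \<phi>[of "F * G"] by (simp add: \<phi> FG)
    qed
    show "\<phi> (v i) = v' i" for i using \<phi>[of "free_gen i"] by simp
  qed
qed

lemma presented_by_induct:
  assumes "algebra_over_field sc" "presented_by sc v R"
    and one: "P 1" and gen: "\<And>i. P (v i)"
    and add: "\<And>a b. P a \<Longrightarrow> P b \<Longrightarrow> P (a + b)" and scale: "\<And>c a. P a \<Longrightarrow> P (sc c a)"
    and mult: "\<And>a b. P a \<Longrightarrow> P b \<Longrightarrow> P (a * b)"
  shows "P a"
proof -
  interpret algebra_over_field sc by fact
  obtain F where F: "a = free_eval sc v F"
    using assms(2) unfolding presented_by_def by (metis UNIV_I imageE)
  have zero: "P 0" using scale[OF one, of 0] by simp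
  have word: "P (prod_list (map v ws))" for ws
    by (induction ws) (auto intro: one mult gen)
  have "P (\<Sum>w\<in>W. sc (Poly_Mapping.lookup F w) (prod_list (map v (letters w))))" for W
    by (induction W rule: infinite_finite_induct) (auto intro: zero add scale word)
  then show ?thesis by (simp add: F free_eval_def)
qed

section \<open>Algebra homomorphisms\<close>

definition algebra_hom ::
  "('k::field \<Rightarrow> 'h::ring_1 \<Rightarrow> 'h) \<Rightarrow> ('k \<Rightarrow> 'g::ring_1 \<Rightarrow> 'g) \<Rightarrow> ('h \<Rightarrow> 'g) \<Rightarrow> bool" where
  "algebra_hom sc sc' \<phi> \<longleftrightarrow>
     Vector_Spaces.linear sc sc' \<phi> \<and> \<phi> 1 = 1 \<and> (\<forall>a b. \<phi> (a * b) = \<phi> a * \<phi> b)"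

lemma algebra_character_iff_hom: "algebra_character sc \<beta> \<longleftrightarrow> algebra_hom sc (*) \<beta>"
  by (simp add: algebra_character_def algebra_hom_def)

lemma algebra_homD:
  assumes "algebra_hom sc sc' \<phi>"
  shows "\<phi> 1 = 1" "\<phi> (a * b) = \<phi> a * \<phi> b" "\<phi> (a + b) = \<phi> a + \<phi> b" "\<phi> (sc c a) = sc' c (\<phi> a)"
    "\<phi> (a ^ m) = \<phi> a ^ m" "\<phi> 0 = 0" "\<phi> (- a) = - \<phi> a"
proof -
  show one: "\<phi> 1 = 1" and mult: "\<phi> (a * b) = \<phi> a * \<phi> b" for a b
    using assms by (auto simp: algebra_hom_def)
  show add: "\<phi> (a + b) = \<phi> a + \<phi> b" and "\<phi> (sc c a) = sc' c (\<phi> a)" for a b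
    using assms unfolding algebra_hom_def Vector_Spaces.linear_iff by auto
  show "\<phi> (a ^ m) = \<phi> a ^ m"
    by (induction m) (simp_all add: one mult)
  show zero: "\<phi> 0 = 0" using add[of 0 0] by simp
  show "\<phi> (- a) = - \<phi> a" using add[of "- a" a] zero by (simp add: eq_neg_iff_add_eq_0)
qed

lemma presented_by_hom_eqI:
  assumes "algebra_over_field sc" "presented_by sc v R"
    and "algebra_hom sc sc' \<phi>" "algebra_hom sc sc' \<psi>"
    and "\<And>i. \<phi> (v i) = \<psi> (v i)"
  shows "\<phi> = \<psi>"
proof
  fix a show "\<phi> a = \<psi> a"
    by (rule presented_by_induct[OF assms(1,2)])
      (simp_all add: algebra_homD[OF assms(3)] algebra_homD[OF assms(4)] assms(5))
qed

lemma vector_space_field: "vector_space ((*) :: 'k::field \<Rightarrow> 'k \<Rightarrow> 'k)"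
  by unfold_locales (auto simp: algebra_simps)

lemma algebra_over_field_self: "algebra_over_field ((*) :: 'k::field \<Rightarrow> 'k \<Rightarrow> 'k)"
  by unfold_locales (auto simp: algebra_simps)

text \<open>
  Sweedler sums over two unrelated coproducts may be interchanged.
\<close>

lemma sum_list_swap:
  "(\<Sum>x\<leftarrow>xs. \<Sum>y\<leftarrow>ys. f x y) = (\<Sum>y\<leftarrow>ys. \<Sum>x\<leftarrow>xs. f x y :: 'a::comm_monoid_add)"
  by (induction xs) (simp_all add: sum_list_addf)

section \<open>Sweedler calculus\<close>

context hopf_algebra
begin

sublocale algebra_over_field sc
  by unfold_locales (rule scale_mult_left scale_mult_right)+

lemma antipode_add: "S (a + b) = S a + S b" and antipode_scale: "S (sc c a) = sc c (S a)"
  using antipode_linear unfolding Vector_Spaces.linear_iff by blast+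

lemma antipode_minus: "S (- a) = - S a"
  using antipode_scale[of "- 1" a] by simp

text \<open>The axioms in the form that they take once pair patterns are replaced by projections.\<close>

lemmas hopf_fst_snd = antipode_left[unfolded case_prod_unfold] antipode_right[unfolded case_prod_unfold]
  counit_left[unfolded case_prod_unfold] counit_right[unfolded case_prod_unfold]

lemma linear_sum_list:
  assumes "Vector_Spaces.linear sc sc' T"
  shows "T (\<Sum>i\<leftarrow>xs. f i) = (\<Sum>i\<leftarrow>xs. T (f i))"
proof -
  have T: "T (a + b) = T a + T b" for a b using assms unfolding Vector_Spaces.linear_iff by blast
  have "T 0 = 0" using T[of 0 0] by simp
  then show ?thesis by (induction xs) (simp_all add: T)
qed

lemma scale_sum_list: "sc c (\<Sum>i\<leftarrow>xs. f i) = (\<Sum>i\<leftarrow>xs. sc c (f i))"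
  by (induction xs) (simp_all add: scale_right_distrib)

text \<open>
  The chosen representatives \<open>\<Delta> h\<close> need not depend linearly on \<open>h\<close>; what they evaluate to
  under a bilinear map does, since such a map factors through the tensor product.
\<close>

lemma linear_sweedler:
  assumes left: "\<And>b. Vector_Spaces.linear sc sc' (\<lambda>a. B a b)"
    and right: "\<And>a. Vector_Spaces.linear sc sc' (B a)"
  shows "Vector_Spaces.linear sc sc' (\<lambda>h. \<Sum>(a, b)\<leftarrow>\<Delta> h. B a b)"
proof -
  interpret V: vector_space sc' using right unfolding Vector_Spaces.linear_iff by blast
  have B: "B (sc c a) b = sc' c (B a b)" for c a b
    using left[of b] unfolding Vector_Spaces.linear_iff by blast
  have "(\<Sum>(a, b)\<leftarrow>[(sc c a1, a2). (a1, a2) \<leftarrow> t]. B a b) = sc' c (\<Sum>(a, b)\<leftarrow>t. B a b)" for c t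
    by (induction t) (auto simp: B V.scale_right_distrib)
  then show ?thesis
    using tensor_eq_bilinear[OF comult_add left right] tensor_eq_bilinear[OF comult_scale left right]
    unfolding Vector_Spaces.linear_iff by (auto intro: vector_space_axioms V.vector_space_axioms)
qed

lemma sweedler_mult:
  assumes left: "\<And>b. Vector_Spaces.linear sc sc' (\<lambda>a. B a b)"
    and right: "\<And>a. Vector_Spaces.linear sc sc' (B a)"
  shows "(\<Sum>(a, b)\<leftarrow>\<Delta> (u * v). B a b) =
    (\<Sum>(a, b)\<leftarrow>\<Delta> u. \<Sum>(c, d)\<leftarrow>\<Delta> v. B (a * c) (b * d))"
proof -
  have "(\<Sum>(a, b)\<leftarrow>tensor_mult s t. B a b) = (\<Sum>(a, b)\<leftarrow>s. \<Sum>(c, d)\<leftarrow>t. B (a * c) (b * d))" for s t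
    unfolding tensor_mult_def by (induction s) (auto simp: comp_def case_prod_unfold)
  then show ?thesis
    using tensor_eq_bilinear[OF comult_mult left right] by simp
qed

lemma sweedler_coassoc:
  assumes "\<And>b c. Vector_Spaces.linear sc sc' (\<lambda>a. B a b c)"
    and "\<And>a c. Vector_Spaces.linear sc sc' (\<lambda>b. B a b c)"
    and "\<And>a b. Vector_Spaces.linear sc sc' (B a b)"
  shows "(\<Sum>(a', a3)\<leftarrow>\<Delta> a. \<Sum>(a1, a2)\<leftarrow>\<Delta> a'. B a1 a2 a3) =
    (\<Sum>(a1, a')\<leftarrow>\<Delta> a. \<Sum>(a2, a3)\<leftarrow>\<Delta> a'. B a1 a2 a3)"
proof -
  have 3: "(\<Sum>(a, b, c)\<leftarrow>[(a11, a12, a2). (a1, a2) \<leftarrow> t, (a11, a12) \<leftarrow> \<Delta> a1]. B a b c) =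
      (\<Sum>(a', a3)\<leftarrow>t. \<Sum>(a1, a2)\<leftarrow>\<Delta> a'. B a1 a2 a3)" for t
    by (induction t) (auto simp: comp_def case_prod_unfold)
  have 4: "(\<Sum>(a, b, c)\<leftarrow>[(a1, a21, a22). (a1, a2) \<leftarrow> t, (a21, a22) \<leftarrow> \<Delta> a2]. B a b c) =
      (\<Sum>(a1, a')\<leftarrow>t. \<Sum>(a2, a3)\<leftarrow>\<Delta> a'. B a1 a2 a3)" for t
    by (induction t) (auto simp: comp_def case_prod_unfold)
  show ?thesis
    using tensor3_eq_trilinear[OF coassoc assms, of a] unfolding 3 4 .
qed

text \<open>
  Convolution by the identity from the right is undone by convolution by \<open>S\<close>. The element \<open>v\<close>
  in between is what allows the cancellation to be carried out in one of two factors while the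
  other one is held fixed, as needed for \<open>antipode_mult\<close>.
\<close>

lemma convolution_antipode_cancel:
  assumes T: "Vector_Spaces.linear sc sc T"
    and F: "\<And>b. (\<Sum>(b1, b2)\<leftarrow>\<Delta> b. T b1 * v * b2) = F b"
  shows "T b * v = (\<Sum>(b1, b2)\<leftarrow>\<Delta> b. F b1 * S b2)"
proof -
  have T': "T (a + b) = T a + T b" "T (sc c a) = sc c (T a)" for a b c
    using T unfolding Vector_Spaces.linear_iff by blast+
  have "(\<Sum>(b1, b2)\<leftarrow>\<Delta> b. F b1 * S b2) =
      (\<Sum>(b', b3)\<leftarrow>\<Delta> b. \<Sum>(b1, b2)\<leftarrow>\<Delta> b'. T b1 * v * b2 * S b3)"
    by (simp add: F[symmetric] case_prod_unfold sum_list_mult_const)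
  also have "\<dots> = (\<Sum>(b1, b')\<leftarrow>\<Delta> b. \<Sum>(b2, b3)\<leftarrow>\<Delta> b'. T b1 * v * b2 * S b3)"
    by (rule sweedler_coassoc[where sc' = sc])
      (auto simp: Vector_Spaces.linear_iff vector_space_axioms T' algebra_simps scale_mult
        antipode_add antipode_scale)
  also have "\<dots> = (\<Sum>(b1, b')\<leftarrow>\<Delta> b. T b1 * v * (\<Sum>(b2, b3)\<leftarrow>\<Delta> b'. b2 * S b3))"
    by (simp add: case_prod_unfold sum_list_const_mult mult.assoc)
  also have "\<dots> = (\<Sum>(b1, b')\<leftarrow>\<Delta> b. T (sc (\<epsilon> b') b1)) * v"
    by (simp add: hopf_fst_snd scale_mult T' case_prod_unfold flip: sum_list_mult_const)
  also have "\<dots> = T b * v"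
    using linear_sum_list[OF T, of "\<lambda>(b1, b2). sc (\<epsilon> b2) b1" "\<Delta> b"]
    by (simp add: hopf_fst_snd case_prod_unfold)
  finally show ?thesis by simp
qed

text \<open>
  The antipode reverses products because \<open>(a, b) \<mapsto> S (a b)\<close> and \<open>(a, b) \<mapsto> S b S a\<close> are both
  convolution inverse to the multiplication. The proof cancels first in \<open>b\<close> and then in \<open>a\<close>.
\<close>

lemma antipode_mult: "S (a * b) = S b * S a"
proof -
  have ab: "(\<Sum>(a1, a2)\<leftarrow>\<Delta> a. \<Sum>(b1, b2)\<leftarrow>\<Delta> b. S (a1 * b1) * a2 * b2) = sc (\<epsilon> a * \<epsilon> b) 1" for a b
    using sweedler_mult[of sc "\<lambda>u v. S u * v" a b]
    by (simp add: Vector_Spaces.linear_iff vector_space_axioms algebra_simps scale_mult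
        antipode_add antipode_scale antipode_left counit_mult)
  have "(\<Sum>(a1, a2)\<leftarrow>\<Delta> a. S (a1 * b) * a2) = sc (\<epsilon> a) (S b)" for a
  proof -
    have cancel: "S (u * b) * v = (\<Sum>(b', b3)\<leftarrow>\<Delta> b. (\<Sum>(b1, b2)\<leftarrow>\<Delta> b'. S (u * b1) * v * b2) * S b3)"
      for u v
      by (rule convolution_antipode_cancel)
        (auto simp: Vector_Spaces.linear_iff vector_space_axioms algebra_simps scale_mult
        antipode_add antipode_scale)
    have "(\<Sum>(a1, a2)\<leftarrow>\<Delta> a. S (a1 * b) * a2) = (\<Sum>(b', b3)\<leftarrow>\<Delta> b.
        (\<Sum>(a1, a2)\<leftarrow>\<Delta> a. \<Sum>(b1, b2)\<leftarrow>\<Delta> b'. S (a1 * b1) * a2 * b2) * S b3)"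
      unfolding cancel case_prod_unfold by (subst sum_list_swap) (simp add: sum_list_mult_const)
    also have "\<dots> = sc (\<epsilon> a) (\<Sum>(b', b3)\<leftarrow>\<Delta> b. S (sc (\<epsilon> b') b3))"
      by (simp add: ab[unfolded case_prod_unfold] scale_mult antipode_scale scale_sum_list case_prod_unfold)
    also have "\<dots> = sc (\<epsilon> a) (S b)"
      using linear_sum_list[OF antipode_linear, of "\<lambda>(b1, b2). sc (\<epsilon> b1) b2" "\<Delta> b"]
      by (simp add: hopf_fst_snd case_prod_unfold)
    finally show ?thesis .
  qed
  then have "S (a * b) * 1 = (\<Sum>(a1, a2)\<leftarrow>\<Delta> a. sc (\<epsilon> a1) (S b) * S a2)"
    by (intro convolution_antipode_cancel)
      (auto simp: Vector_Spaces.linear_iff vector_space_axioms algebra_simps scale_mult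
        antipode_add antipode_scale)
  also have "\<dots> = S b * (\<Sum>(a1, a2)\<leftarrow>\<Delta> a. S (sc (\<epsilon> a1) a2))"
    by (simp add: case_prod_unfold antipode_scale scale_mult flip: sum_list_const_mult)
  also have "\<dots> = S b * S a"
    using linear_sum_list[OF antipode_linear, of "\<lambda>(b1, b2). sc (\<epsilon> b1) b2" "\<Delta> a"]
    by (simp add: hopf_fst_snd case_prod_unfold)
  finally show ?thesis by simp
qed

lemma antipode_one: "S 1 = 1"
proof -
  have "(\<Sum>(a, b)\<leftarrow>\<Delta> 1. S a * b) = (\<Sum>(a, b)\<leftarrow>[(1, 1)]. S a * b)"
    by (rule tensor_eq_bilinear[OF comult_one, where sc' = sc])
      (auto simp: Vector_Spaces.linear_iff vector_space_axioms algebra_simps scale_mult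
        antipode_add antipode_scale)
  then show ?thesis by (simp add: antipode_left counit_one)
qed

lemma antipode_power: "S (a ^ m) = S a ^ m"
  by (induction m) (simp_all add: antipode_one antipode_mult power_commutes)

lemma algebra_hom_antipode_square: "algebra_hom sc sc (\<lambda>h. S (S h))"
  by (simp add: algebra_hom_def Vector_Spaces.linear_iff vector_space_axioms antipode_add
      antipode_scale antipode_one antipode_mult)

lemma character_antipode:
  assumes "algebra_character sc \<beta>"
  shows "algebra_character sc (\<beta> \<circ> S)"
  using assms by (auto simp: algebra_character_def Vector_Spaces.linear_iff antipode_add
      antipode_scale antipode_one antipode_mult)

text \<open>
  The left and right actions of the dual on \<open>H\<close>. For a character they are automorphisms, and the
  condition on a pair in involution is about their composite with a conjugation.
\<close>

definition left_twist :: "('h \<Rightarrow> 'k) \<Rightarrow> 'h \<Rightarrow> 'h" where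
  "left_twist \<gamma> h = (\<Sum>(h1, h2)\<leftarrow>\<Delta> h. sc (\<gamma> h1) h2)"

definition right_twist :: "('h \<Rightarrow> 'k) \<Rightarrow> 'h \<Rightarrow> 'h" where
  "right_twist \<gamma> h = (\<Sum>(h1, h2)\<leftarrow>\<Delta> h. sc (\<gamma> h2) h1)"

text \<open>
  As the coproduct is multiplicative, a bilinear map that is multiplicative on pure tensors
  yields an algebra homomorphism. Twists by characters and convolution products of characters
  are of this form.
\<close>

lemma sweedler_hom:
  assumes aof: "algebra_over_field sc'"
    and left: "\<And>b. Vector_Spaces.linear sc sc' (\<lambda>a. B a b)"
    and right: "\<And>a. Vector_Spaces.linear sc sc' (B a)"
    and one: "B 1 1 = 1"
    and mult: "\<And>a b c d. B (a * c) (b * d) = B a b * B c d"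
  shows "algebra_hom sc sc' (\<lambda>h. \<Sum>(a, b)\<leftarrow>\<Delta> h. B a b)"
  unfolding algebra_hom_def
proof (intro conjI allI)
  show "Vector_Spaces.linear sc sc' (\<lambda>h. \<Sum>(a, b)\<leftarrow>\<Delta> h. B a b)"
    by (rule linear_sweedler[OF left right])
  show "(\<Sum>(a, b)\<leftarrow>\<Delta> 1. B a b) = 1"
    using tensor_eq_bilinear[OF comult_one left right] by (simp add: one)
  show "(\<Sum>(a, b)\<leftarrow>\<Delta> (u * v). B a b) = (\<Sum>(a, b)\<leftarrow>\<Delta> u. B a b) * (\<Sum>(a, b)\<leftarrow>\<Delta> v. B a b)" for u v
    unfolding sweedler_mult[OF left right]
    by (simp add: mult case_prod_unfold sum_list_const_mult sum_list_mult_const)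
qed

lemma algebra_hom_twists:
  assumes "algebra_character sc \<gamma>"
  shows "algebra_hom sc sc (left_twist \<gamma>)" "algebra_hom sc sc (right_twist \<gamma>)"
proof -
  note \<gamma> = algebra_homD[OF assms[unfolded algebra_character_iff_hom]]
  show "algebra_hom sc sc (left_twist \<gamma>)" "algebra_hom sc sc (right_twist \<gamma>)"
    unfolding left_twist_def[abs_def] right_twist_def[abs_def]
    by (rule sweedler_hom, unfold_locales,
        auto simp: Vector_Spaces.linear_iff vector_space_axioms \<gamma> algebra_simps scale_mult)+
qed

lemma character_convolution:
  assumes "algebra_character sc \<gamma>" "algebra_character sc \<delta>"
  shows "algebra_character sc (\<lambda>h. \<Sum>(h1, h2)\<leftarrow>\<Delta> h. \<gamma> h1 * \<delta> h2)"
proof -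
  note [simp] = algebra_homD[OF assms(1)[unfolded algebra_character_iff_hom]]
    algebra_homD[OF assms(2)[unfolded algebra_character_iff_hom]]
  show ?thesis
    unfolding algebra_character_iff_hom
    by (rule sweedler_hom[OF algebra_over_field_self])
      (auto simp: Vector_Spaces.linear_iff vector_space_axioms vector_space_field algebra_simps)
qed

text \<open>
  Factoring the right-hand side of the condition on a pair in involution into two twists and
  a conjugation shows at once that it is multiplicative in \<open>h\<close>; this reduces the condition to
  the algebra generators.
\<close>

lemma twisted_conjugation:
  assumes "algebra_character sc \<beta>"
  shows "(\<Sum>(h1, h2, h3)\<leftarrow>comult2 \<Delta> h. sc (\<beta> h3 * \<beta> (S h1)) (l * h2 * l')) =
    l * left_twist (\<beta> \<circ> S) (right_twist \<beta> h) * l'"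
proof -
  have hom: "algebra_hom sc sc (left_twist (\<beta> \<circ> S))"
    by (rule algebra_hom_twists) (rule character_antipode[OF assms])
  then have lin: "Vector_Spaces.linear sc sc (left_twist (\<beta> \<circ> S))" by (simp add: algebra_hom_def)
  have "(\<Sum>(h1, h2, h3)\<leftarrow>[(h1, h2, h3). (h', h3) \<leftarrow> t, (h1, h2) \<leftarrow> \<Delta> h'].
        sc (\<beta> h3 * \<beta> (S h1)) (l * h2 * l')) =
      (\<Sum>(h', h3)\<leftarrow>t. \<Sum>(h1, h2)\<leftarrow>\<Delta> h'. sc (\<beta> h3 * \<beta> (S h1)) (l * h2 * l'))" for t
    by (induction t) (auto simp: comp_def case_prod_unfold)
  then have "(\<Sum>(h1, h2, h3)\<leftarrow>comult2 \<Delta> h. sc (\<beta> h3 * \<beta> (S h1)) (l * h2 * l')) =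
      (\<Sum>(h', h3)\<leftarrow>\<Delta> h. \<Sum>(h1, h2)\<leftarrow>\<Delta> h'. sc (\<beta> h3 * \<beta> (S h1)) (l * h2 * l'))"
    by (simp add: comult2_def)
  also have "\<dots> = (\<Sum>(h', h3)\<leftarrow>\<Delta> h. sc (\<beta> h3) (l * left_twist (\<beta> \<circ> S) h' * l'))"
    by (simp add: left_twist_def case_prod_unfold scale_sum_list scale_mult
        flip: sum_list_const_mult sum_list_mult_const)
  also have "\<dots> = l * (\<Sum>(h', h3)\<leftarrow>\<Delta> h. left_twist (\<beta> \<circ> S) (sc (\<beta> h3) h')) * l'"
    by (simp add: algebra_homD[OF hom] case_prod_unfold scale_mult
        flip: sum_list_const_mult sum_list_mult_const)
  also have "\<dots> = l * left_twist (\<beta> \<circ> S) (right_twist \<beta> h) * l'"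
    by (simp add: right_twist_def linear_sum_list[OF lin] case_prod_unfold)
  finally show ?thesis .
qed

lemma algebra_hom_twisted_conjugation:
  assumes "algebra_character sc \<beta>" "l' * l = 1" "l * l' = 1"
  shows "algebra_hom sc sc (\<lambda>h. l * left_twist (\<beta> \<circ> S) (right_twist \<beta> h) * l')"
proof -
  note L = algebra_homD[OF algebra_hom_twists(1)[OF character_antipode[OF assms(1)]]]
  note R = algebra_homD[OF algebra_hom_twists(2)[OF assms(1)]]
  have "l * (a * b) * l' = l * a * l' * (l * b * l')" for a b
  proof -
    have "l * a * l' * (l * b * l') = l * a * (l' * l) * b * l'" by (simp only: mult.assoc)
    then show ?thesis by (simp add: assms mult.assoc)
  qed
  then show ?thesis
    by (simp add: algebra_hom_def Vector_Spaces.linear_iff vector_space_axioms L R assms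
        algebra_simps scale_mult)
qed

lemma pair_in_involution_iff:
  "pair_in_involution sc \<Delta> \<epsilon> S l \<beta> \<longleftrightarrow> grouplike sc \<Delta> \<epsilon> l \<and> algebra_character sc \<beta> \<and>
    (\<exists>l'. l * l' = 1 \<and> l' * l = 1 \<and>
      (\<forall>h. S (S h) = l * left_twist (\<beta> \<circ> S) (right_twist \<beta> h) * l'))"
  unfolding pair_in_involution_def using twisted_conjugation by (simp cong: conj_cong)

end

section \<open>Roots of unity\<close>

lemma primitive_root_powi_eq_iff:
  assumes "primitive_root_of_unity N q"
  shows "q powi s = q powi t \<longleftrightarrow> [s = t] (mod int N)"
proof -
  have q: "q ^ N = 1" "N > 0" "\<And>d. 0 < d \<Longrightarrow> d < N \<Longrightarrow> q ^ d \<noteq> 1"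
    using assms by (auto simp: primitive_root_of_unity_def)
  then have nz: "q \<noteq> 0" by (metis power_0_left zero_neq_one not_gr0)
  have eq_one: "q powi r = 1 \<longleftrightarrow> int N dvd r" for r
  proof -
    define d where "d = nat (r mod int N)"
    have d: "int d = r mod int N" "d < N" using q(2) by (auto simp: d_def nat_less_iff)
    have "q powi r = q powi (int N * (r div int N)) * q powi (int d)"
      unfolding d by (subst power_int_add[symmetric]) (simp_all add: nz)
    also have "\<dots> = q ^ d" by (simp add: power_int_mult q)
    finally have "q powi r = 1 \<longleftrightarrow> d = 0" using q(3)[of d] d(2) by auto
    then show ?thesis using d by (auto simp: dvd_eq_mod_eq_0)
  qed
  have "q powi s = q powi t \<longleftrightarrow> q powi (s - t) = 1"
    using nz by (simp add: power_int_diff)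
  then show ?thesis by (simp add: eq_one cong_iff_dvd_diff)
qed

text \<open>
  The polynomial \<open>X\<^sup>N - 1\<close> has at most \<open>N\<close> roots, and the powers of \<open>q\<close> already provide \<open>N\<close> of
  them.
\<close>

lemma primitive_root_generates:
  fixes q w :: "'k::field"
  assumes "primitive_root_of_unity N q" "w ^ N = 1"
  obtains d where "w = q ^ d"
proof -
  have q: "q ^ N = 1" "N > 0" using assms(1) by (auto simp: primitive_root_of_unity_def)
  let ?p = "Polynomial.monom 1 N - 1 :: 'k poly"
  have "coeff ?p N = 1" using q(2) by (simp add: Polynomial.coeff_monom)
  then have p: "?p \<noteq> 0" by (metis coeff_0 zero_neq_one)
  have deg: "degree ?p \<le> N" by (intro degree_diff_le) (simp_all add: degree_monom_le)
  have "inj_on (\<lambda>d. q ^ d) {..<N}"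
  proof
    fix i j assume "i \<in> {..<N}" "j \<in> {..<N}" "q ^ i = q ^ j"
    then show "i = j"
      using primitive_root_powi_eq_iff[OF assms(1), of "int i" "int j"] by (simp add: cong_def)
  qed
  then have card: "card ((\<lambda>d. q ^ d) ` {..<N}) = N" by (simp add: card_image)
  have "(\<lambda>d. q ^ d) ` {..<N} \<subseteq> {z. poly ?p z = 0}"
    by (auto simp: poly_monom power_mult[symmetric] mult.commute[of _ N] q power_mult)
  then have "(\<lambda>d. q ^ d) ` {..<N} = {z. poly ?p z = 0}"
    using card_poly_roots_bound[OF p] by (intro card_seteq poly_roots_finite p) (use deg in \<open>simp_all add: card\<close>)
  moreover have "w \<in> {z. poly ?p z = 0}" using assms(2) by (simp add: poly_monom)
  ultimately show thesis using that by auto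
qed

section \<open>Lower triangular two-by-two matrices\<close>

text \<open>
  The matrix with diagonal \<open>(a, b)\<close> and lower left entry \<open>c\<close> is \<open>LT a b c\<close>. A homomorphism into
  these matrices consists of two characters, on the diagonal, and a skew derivation between them.
\<close>

datatype 'k lower_triangular = LT (upper_diagonal: 'k) (lower_diagonal: 'k) (corner: 'k)

instantiation lower_triangular :: (comm_ring_1) ring_1
begin

definition "0 = LT 0 0 0"
definition "1 = LT 1 1 0"
fun plus_lower_triangular where "LT a b c + LT a' b' c' = LT (a + a') (b + b') (c + c')"
fun uminus_lower_triangular where "- LT a b c = LT (- a) (- b) (- c)"
fun minus_lower_triangular where "LT a b c - LT a' b' c' = LT (a - a') (b - b') (c - c')"
fun times_lower_triangular where
  "LT a b c * LT a' b' c' = LT (a * a') (b * b') (c * a' + b * c')"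

instance
proof
  fix u v w :: "'a lower_triangular"
  obtain a b c a' b' c' a'' b'' c'' where "u = LT a b c" "v = LT a' b' c'" "w = LT a'' b'' c''"
    by (metis lower_triangular.exhaust)
  note [simp] = this
  show "u * v * w = u * (v * w)" "1 * u = u" "u * 1 = u" "u + v + w = u + (v + w)" "u + v = v + u"
    "0 + u = u" "- u + u = 0" "u - v = u + - v" "(u + v) * w = u * w + v * w"
    "u * (v + w) = u * v + u * w" "0 \<noteq> (1 :: 'a lower_triangular)"
    by (simp_all add: zero_lower_triangular_def one_lower_triangular_def algebra_simps)
qed

end

fun lower_triangular_scale :: "'k::field \<Rightarrow> 'k lower_triangular \<Rightarrow> 'k lower_triangular" where
  "lower_triangular_scale r (LT a b c) = LT (r * a) (r * b) (r * c)"

lemma algebra_over_field_lower_triangular: "algebra_over_field (lower_triangular_scale :: 'k::field \<Rightarrow> _)"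
proof
  fix r s :: 'k and u v :: "'k lower_triangular"
  obtain a b c a' b' c' where "u = LT a b c" "v = LT a' b' c'"
    by (metis lower_triangular.exhaust)
  note [simp] = this
  show "lower_triangular_scale r (u + v) = lower_triangular_scale r u + lower_triangular_scale r v"
    "lower_triangular_scale (r + s) u = lower_triangular_scale r u + lower_triangular_scale s u"
    "lower_triangular_scale r (lower_triangular_scale s u) = lower_triangular_scale (r * s) u"
    "lower_triangular_scale 1 u = u"
    "lower_triangular_scale r u * v = lower_triangular_scale r (u * v)"
    "u * lower_triangular_scale r v = lower_triangular_scale r (u * v)"
    by (simp_all add: algebra_simps)
qed

lemma lower_triangular_scale_zero [simp]: "lower_triangular_scale c 0 = 0"
  by (simp add: zero_lower_triangular_def)

lemma lower_triangular_diagonal_power: "LT a b 0 ^ m = LT (a ^ m) (b ^ m) 0"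
  by (induction m) (simp_all add: one_lower_triangular_def)

lemma lower_triangular_corner_power: "m \<ge> 2 \<Longrightarrow> LT 0 0 c ^ m = (0 :: 'k::comm_ring_1 lower_triangular)"
  by (induction m rule: dec_induct)
    (simp_all add: power2_eq_square zero_lower_triangular_def)

lemma algebra_hom_diagonals:
  assumes "algebra_hom sc lower_triangular_scale \<Phi>"
  shows "algebra_character sc (upper_diagonal \<circ> \<Phi>)" "algebra_character sc (lower_diagonal \<circ> \<Phi>)"
proof -
  have sel: "upper_diagonal (u + v) = upper_diagonal u + upper_diagonal v"
    "lower_diagonal (u + v) = lower_diagonal u + lower_diagonal v"
    "upper_diagonal (u * v) = upper_diagonal u * upper_diagonal v"
    "lower_diagonal (u * v) = lower_diagonal u * lower_diagonal v"
    "upper_diagonal (lower_triangular_scale r u) = r * upper_diagonal u"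
    "lower_diagonal (lower_triangular_scale r u) = r * lower_diagonal u" 
    for u v :: "'a lower_triangular" and r
    by (cases u; cases v; simp)+
  have "vector_space sc"
    using assms by (simp add: algebra_hom_def Vector_Spaces.linear_iff)
  then show "algebra_character sc (upper_diagonal \<circ> \<Phi>)" "algebra_character sc (lower_diagonal \<circ> \<Phi>)"
    using vector_space_field
    by (simp_all add: algebra_character_iff_hom algebra_hom_def Vector_Spaces.linear_iff sel
        algebra_homD[OF assms] one_lower_triangular_def)
qed

section \<open>Group-like elements\<close>

lemma formal_sum_append: "formal_sum (s @ t) = formal_sum s + formal_sum t"
  by (simp add: formal_sum_def)

lemma tensor_eq_refl: "tensor_eq sc s s"
  by (simp add: tensor_eq_def free_vs.span_zero)

lemma tensor_eq_trans: "tensor_eq sc s t \<Longrightarrow> tensor_eq sc t u \<Longrightarrow> tensor_eq sc s u"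
  unfolding tensor_eq_def by (drule (1) free_vs.span_add) simp

lemma tensor_eq_append:
  "tensor_eq sc s s' \<Longrightarrow> tensor_eq sc t t' \<Longrightarrow> tensor_eq sc (s @ t) (s' @ t')"
  unfolding tensor_eq_def formal_sum_append add_diff_add by (rule free_vs.span_add)

text \<open>
  Functoriality of the tensor product: \<open>f \<otimes> h\<close> maps bilinearity relations to bilinearity
  relations.
\<close>

lemma tensor_eq_map:
  assumes "tensor_eq sc s t" "Vector_Spaces.linear sc sc f" "Vector_Spaces.linear sc sc h"
  shows "tensor_eq sc (map (\<lambda>(a, b). (f a, h b)) s) (map (\<lambda>(a, b). (f a, h b)) t)"
proof -
  let ?E = "linear_extension pm_scale (\<lambda>(a, b). Poly_Mapping.single (f a, h b) 1)
    :: ('b \<times> 'b \<Rightarrow>\<^sub>0 'a) \<Rightarrow> _"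
  have fh: "f (a + b) = f a + f b" "f (sc c a) = sc c (f a)"
    "h (a + b) = h a + h b" "h (sc c a) = sc c (h a)" for a b c
    using assms(2,3) unfolding Vector_Spaces.linear_iff by blast+
  have E: "?E (formal_sum ts) = formal_sum (map (\<lambda>(a, b). (f a, h b)) ts)" for ts
    unfolding free_vs.linear_extension_formal_sum
    by (simp add: formal_sum_def comp_def case_prod_unfold)
  have mem: "formal_sum [(a + a', b)] - formal_sum [(a, b), (a', b)] \<in> bilinearity_relations sc"
    "formal_sum [(a, b + b')] - formal_sum [(a, b), (a, b')] \<in> bilinearity_relations sc"
    "formal_sum [(sc c a, b)] - pm_scale c (formal_sum [(a, b)]) \<in> bilinearity_relations sc"
    "formal_sum [(a, sc c b)] - pm_scale c (formal_sum [(a, b)]) \<in> bilinearity_relations sc"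
    for a a' b b' c
    unfolding bilinearity_relations_def by blast+
  have rel: "?E r \<in> bilinearity_relations sc" if "r \<in> bilinearity_relations sc" for r
    using that[unfolded bilinearity_relations_def]
    by (elim UnE CollectE exE conjE)
      (simp_all add: free_vs.linear_extension_diff free_vs.linear_extension_scale E fh mem)
  have "?E X \<in> free_vs.span (bilinearity_relations sc)"
    if "X \<in> free_vs.span (bilinearity_relations sc)" for X
    using that
    by (induction rule: free_vs.span_induct_alt)
      (auto simp: free_vs.linear_extension_add free_vs.linear_extension_scale
        intro: free_vs.span_zero free_vs.span_add free_vs.span_scale free_vs.span_base rel)
  from this[OF assms(1)[unfolded tensor_eq_def]] show ?thesis
    unfolding tensor_eq_def by (simp only: free_vs.linear_extension_diff E)
qed

context hopf_algebra
begin

text \<open>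
  Multiplication of tensors respects the identifications. It is enough to have this when the
  second factor is a pure tensor, as it is for group-like elements.
\<close>

lemma tensor_eq_tensor_mult:
  assumes "tensor_eq sc s s'" "tensor_eq sc t [(c, d)]"
  shows "tensor_eq sc (tensor_mult s t) (tensor_mult s' [(c, d)])"
proof -
  have left: "Vector_Spaces.linear sc sc ((*) a)" and right: "Vector_Spaces.linear sc sc (\<lambda>b. b * a)" for a
    by (auto simp: Vector_Spaces.linear_iff vector_space_axioms algebra_simps scale_mult)
  have row: "tensor_eq sc [(a * c, b * d). (c, d) \<leftarrow> t] [(a * c, b * d). (c, d) \<leftarrow> [(c, d)]]" for a b
    using tensor_eq_map[OF assms(2) left left] .
  have "tensor_eq sc (tensor_mult s t) (tensor_mult s [(c, d)])"
  proof (induction s)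
    case Nil
    show ?case by (simp add: tensor_mult_def tensor_eq_refl)
  next
    case (Cons p s)
    then show ?case
      using tensor_eq_append[OF row[of "fst p" "snd p"] Cons.IH]
      by (simp add: tensor_mult_def case_prod_unfold)
  qed
  moreover have "tensor_mult s [(c, d)] = map (\<lambda>(a, b). (a * c, b * d)) s" for s
    unfolding tensor_mult_def by (induction s) auto
  ultimately show ?thesis
    using tensor_eq_map[OF assms(1) right right] by (auto intro: tensor_eq_trans)
qed

lemma grouplike_mult:
  assumes "grouplike sc \<Delta> \<epsilon> u" "grouplike sc \<Delta> \<epsilon> v"
  shows "grouplike sc \<Delta> \<epsilon> (u * v)"
proof -
  have "tensor_eq sc (\<Delta> (u * v)) (tensor_mult [(u, u)] [(v, v)])"
    using assms unfolding grouplike_def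
    by (intro tensor_eq_trans[OF comult_mult] tensor_eq_tensor_mult) simp_all
  then show ?thesis using assms by (simp add: grouplike_def counit_mult tensor_mult_def)
qed

lemma grouplike_power: "grouplike sc \<Delta> \<epsilon> u \<Longrightarrow> grouplike sc \<Delta> \<epsilon> (u ^ m)"
proof (induction m)
  case 0
  show ?case unfolding power_0 grouplike_def using comult_one counit_one by blast
qed (simp add: grouplike_mult)

text \<open>
  Evaluation at a group-like element turns convolution of characters into multiplication.
\<close>

lemma character_convolution_grouplike:
  assumes "algebra_character sc \<gamma>" "algebra_character sc \<delta>" "tensor_eq sc (\<Delta> u) [(u, u)]"
  shows "(\<Sum>(h1, h2)\<leftarrow>\<Delta> u. \<gamma> h1 * \<delta> h2) = \<gamma> u * \<delta> u"
proof -
  have "(\<Sum>(h1, h2)\<leftarrow>\<Delta> u. \<gamma> h1 * \<delta> h2) = (\<Sum>(h1, h2)\<leftarrow>[(u, u)]. \<gamma> h1 * \<delta> h2)"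
    by (intro tensor_eq_bilinear[OF assms(3), where sc' = "(*)"])
      (auto simp: Vector_Spaces.linear_iff vector_space_axioms vector_space_field algebra_simps
        algebra_homD[OF assms(1)[unfolded algebra_character_iff_hom]]
        algebra_homD[OF assms(2)[unfolded algebra_character_iff_hom]])
  then show ?thesis by simp
qed

lemma twists_grouplike:
  assumes "algebra_character sc \<gamma>" "tensor_eq sc (\<Delta> u) [(u, u)]"
  shows "left_twist \<gamma> u = sc (\<gamma> u) u" "right_twist \<gamma> u = sc (\<gamma> u) u"
proof -
  note [simp] = algebra_homD[OF assms(1)[unfolded algebra_character_iff_hom]]
  have "left_twist \<gamma> u = (\<Sum>(h1, h2)\<leftarrow>[(u, u)]. sc (\<gamma> h1) h2)"
    unfolding left_twist_def
    by (intro tensor_eq_bilinear[OF assms(2), where sc' = sc])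
      (auto simp: Vector_Spaces.linear_iff vector_space_axioms algebra_simps)
  then show "left_twist \<gamma> u = sc (\<gamma> u) u" by simp
  have "right_twist \<gamma> u = (\<Sum>(h1, h2)\<leftarrow>[(u, u)]. sc (\<gamma> h2) h1)"
    unfolding right_twist_def
    by (intro tensor_eq_bilinear[OF assms(2), where sc' = sc])
      (auto simp: Vector_Spaces.linear_iff vector_space_axioms algebra_simps)
  then show "right_twist \<gamma> u = sc (\<gamma> u) u" by simp
qed

lemma twists_skew_primitive:
  assumes "algebra_character sc \<gamma>" "tensor_eq sc (\<Delta> z) [(1, z), (z, k)]" "\<gamma> z = 0"
  shows "left_twist \<gamma> z = z" "right_twist \<gamma> z = sc (\<gamma> k) z"
proof -
  note [simp] = algebra_homD[OF assms(1)[unfolded algebra_character_iff_hom]]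
  have "left_twist \<gamma> z = (\<Sum>(h1, h2)\<leftarrow>[(1, z), (z, k)]. sc (\<gamma> h1) h2)"
    unfolding left_twist_def
    by (intro tensor_eq_bilinear[OF assms(2), where sc' = sc])
      (auto simp: Vector_Spaces.linear_iff vector_space_axioms algebra_simps)
  then show "left_twist \<gamma> z = z" by (simp add: assms(3))
  have "right_twist \<gamma> z = (\<Sum>(h1, h2)\<leftarrow>[(1, z), (z, k)]. sc (\<gamma> h2) h1)"
    unfolding right_twist_def
    by (intro tensor_eq_bilinear[OF assms(2), where sc' = sc])
      (auto simp: Vector_Spaces.linear_iff vector_space_axioms algebra_simps)
  then show "right_twist \<gamma> z = sc (\<gamma> k) z" by (simp add: assms(3))
qed

end

section \<open>Generalised Taft algebras\<close>

context generalised_taft_algebra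
begin

lemma N_ge_2: "N \<ge> 2"
  using parameter_matrix by (simp add: parameter_matrix_def)

lemma q_power_N: "q ^ N = 1"
  using primitive_root by (simp add: primitive_root_of_unity_def)

lemma q_nonzero: "q \<noteq> 0"
  using q_power_N N_ge_2 by (metis power_0_left zero_neq_one not_numeral_le_zero)

lemmas q_powi_eq_iff = primitive_root_powi_eq_iff[OF primitive_root]

lemma powi_power_N: "(q powi e) ^ N = 1"
proof -
  have "q powi (e * int N) = q powi 0"
    unfolding q_powi_eq_iff by (simp add: cong_0_iff)
  then show ?thesis by (simp add: power_int_power')
qed

definition Nx :: nat where "Nx = additive_order_mod N (a$1$1 * a$1$2)"
definition Ny :: nat where "Ny = additive_order_mod N (a$2$1 * a$2$2)"

text \<open>
  In the two-dimensional representations below \<open>x\<close> and \<open>y\<close> act by matrices of square zero. This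
  is compatible with the relations \<open>x ^ Nx = 0\<close> and \<open>y ^ Ny = 0\<close> because \<open>a\<^sub>1\<^sub>1 a\<^sub>1\<^sub>2 \<noteq> 0\<close> and
  \<open>a\<^sub>2\<^sub>1 a\<^sub>2\<^sub>2 \<noteq> 0\<close> make both exponents at least 2.
\<close>

lemma additive_order_ge_2:
  assumes "\<not> [c = 0] (mod int N)"
  shows "additive_order_mod N c \<ge> 2"
proof -
  let ?P = "\<lambda>d. 0 < d \<and> [int d * c = 0] (mod int N)"
  have "?P N" using N_ge_2 by (simp add: cong_0_iff)
  then have "?P (additive_order_mod N c)"
    unfolding additive_order_mod_def by (rule LeastI)
  moreover from this assms have "additive_order_mod N c \<noteq> 1" by auto
  ultimately show ?thesis by linarith
qed

lemma Nx_Ny_ge_2: "Nx \<ge> 2" "Ny \<ge> 2"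
  using parameter_matrix additive_order_ge_2 by (simp_all add: parameter_matrix_def Nx_def Ny_def)

lemma free_eval_taft_relations:
  assumes "algebra_over_field sc'"
  shows "(\<forall>r\<in>taft_relations N q a. free_eval sc' (case_taft_generator g' x' y') r = 0) \<longleftrightarrow>
    x' ^ Nx = 0 \<and> y' ^ Ny = 0 \<and> x' * y' = sc' (q powi (a$1$1 * a$2$2)) (y' * x') \<and> g' ^ N = 1 \<and>
    g' * x' = sc' (q powi (a$1$2)) (x' * g') \<and> g' * y' = sc' (q powi (a$2$2)) (y' * g')"
proof -
  interpret K: algebra_over_field sc' by fact
  show ?thesis
    by (simp add: taft_relations_def Let_def Nx_def Ny_def K.scale_mult mult.assoc)
qed

lemma relations:
  "x ^ Nx = 0" "y ^ Ny = 0" "g ^ N = 1"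
  "g * x = sc (q powi (a$1$2)) (x * g)" "g * y = sc (q powi (a$2$2)) (y * g)"
  using free_eval_taft_relations[OF algebra_over_field_axioms, of g x y]
    presented_by_relation[OF presentation] by auto

lemma hom_exists:
  assumes "algebra_over_field sc'"
    and "x' ^ Nx = 0" "y' ^ Ny = 0" "x' * y' = sc' (q powi (a$1$1 * a$2$2)) (y' * x')" "g' ^ N = 1"
    and "g' * x' = sc' (q powi (a$1$2)) (x' * g')" "g' * y' = sc' (q powi (a$2$2)) (y' * g')"
  obtains \<phi> where "algebra_hom sc sc' \<phi>" "\<phi> g = g'" "\<phi> x = x'" "\<phi> y = y'"
proof -
  have "free_eval sc' (case_taft_generator g' x' y') r = 0" if "r \<in> taft_relations N q a" for r
    using free_eval_taft_relations[OF assms(1), of g' x' y'] assms that by blast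
  from presented_by_universal[OF algebra_over_field_axioms assms(1) presentation this]
  obtain \<phi> where "Vector_Spaces.linear sc sc' \<phi>" "\<phi> 1 = 1" "\<And>a b. \<phi> (a * b) = \<phi> a * \<phi> b"
    and v: "\<And>i. \<phi> (case_taft_generator g x y i) = case_taft_generator g' x' y' i" by metis
  then have "algebra_hom sc sc' \<phi>" by (simp add: algebra_hom_def)
  with v[of Gen_g] v[of Gen_x] v[of Gen_y] show thesis by (intro that[of \<phi>]) simp_all
qed

lemma hom_eqI:
  assumes "algebra_hom sc sc' \<phi>" "algebra_hom sc sc' \<psi>"
    and "\<phi> g = \<psi> g" "\<phi> x = \<psi> x" "\<phi> y = \<psi> y"
  shows "\<phi> = \<psi>"
proof (rule presented_by_hom_eqI[OF algebra_over_field_axioms presentation assms(1,2)])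
  show "\<phi> (case_taft_generator g x y i) = \<psi> (case_taft_generator g x y i)" for i
    by (cases i) (simp_all only: taft_generator.case assms(3-5))
qed

subsection \<open>Powers of g\<close>

abbreviation G :: "int \<Rightarrow> 'h" where "G c \<equiv> power_mod N g c"

lemma power_mod_eqI:
  assumes "[int m = c] (mod int N)"
  shows "G c = g ^ m"
proof -
  have "nat (c mod int N) = m mod N"
    using assms by (simp add: cong_def nat_mod_distrib flip: zmod_int)
  moreover have "g ^ m = g ^ (N * (m div N) + m mod N)" by simp
  then have "g ^ m = g ^ (m mod N)" by (simp only: power_add power_mult relations(3)) simp
  ultimately show ?thesis by (simp add: power_mod_def)
qed

lemma power_mod_exponent: "\<exists>m. [int m = c] (mod int N)"
  using N_ge_2 by (intro exI[of _ "nat (c mod int N)"]) (simp add: cong_def)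

lemma power_mod_add: "G (c + d) = G c * G d"
proof -
  obtain m k where "[int m = c] (mod int N)" "[int k = d] (mod int N)"
    using power_mod_exponent by metis
  moreover from this have "[int (m + k) = c + d] (mod int N)" by (simp add: cong_add)
  ultimately show ?thesis by (simp only: power_mod_eqI power_add)
qed

lemma power_mod_zero: "G 0 = 1"
  using power_mod_eqI[of 0 0] by simp

lemma power_mod_inverse: "G c * G (- c) = 1" "G (- c) * G c = 1"
  by (simp_all add: power_mod_zero flip: power_mod_add)

lemma power_mod_1: "G 1 = g"
  using power_mod_eqI[of 1 1] by simp

lemma power_mod_commute:
  assumes "g * z = sc (q powi b) (z * g)"
  shows "G c * z = sc (q powi (b * c)) (z * G c)"
proof -
  obtain m where m: "[int m = c] (mod int N)" using power_mod_exponent by blast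
  have "g ^ m * z = sc (q powi (b * int m)) (z * g ^ m)"
  proof (induction m)
    case (Suc m)
    have "g ^ Suc m * z = g * (g ^ m * z)" by (simp add: mult.assoc)
    also have "\<dots> = sc (q powi (b * int m)) (g * z * g ^ m)"
      by (simp add: Suc scale_mult mult.assoc)
    also have "\<dots> = sc (q powi (b * int m) * q powi b) (z * g ^ Suc m)"
      by (simp add: assms scale_mult mult.assoc)
    finally show ?case by (simp add: q_nonzero algebra_simps flip: power_int_add)
  qed simp
  moreover have "q powi (b * int m) = q powi (b * c)"
    using m by (simp add: q_powi_eq_iff cong_mult)
  ultimately show ?thesis by (simp add: power_mod_eqI[OF m])
qed

text \<open>
  That \<open>\<epsilon> g = 1\<close> follows from the antipode axiom for \<open>g\<close>, as \<open>S g\<close> is known to be the inverse of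
  \<open>g\<close>.
\<close>

lemma grouplike_power_mod: "grouplike sc \<Delta> \<epsilon> (G c)"
proof -
  have "(\<Sum>(h1, h2)\<leftarrow>\<Delta> g. S h1 * h2) = (\<Sum>(h1, h2)\<leftarrow>[(g, g)]. S h1 * h2)"
    by (rule tensor_eq_bilinear[OF comult_g, where sc' = sc])
      (auto simp: Vector_Spaces.linear_iff vector_space_axioms algebra_simps scale_mult
        antipode_add antipode_scale)
  then have "sc (\<epsilon> g) 1 = G (- 1) * G 1" by (simp add: antipode_left antipode_g power_mod_1)
  then have "sc (\<epsilon> g - 1) 1 = 0" by (simp add: power_mod_inverse scale_left_diff_distrib)
  then have "\<epsilon> g = 1" by simp
  then have "grouplike sc \<Delta> \<epsilon> g" by (simp add: grouplike_def comult_g)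
  then show ?thesis unfolding power_mod_def by (rule grouplike_power)
qed

lemma antipode_power_mod: "S (G c) = G (- c)"
proof -
  obtain m where m: "[int m = c] (mod int N)" using power_mod_exponent by blast
  obtain k where k: "[int k = - 1] (mod int N)" using power_mod_exponent by blast
  have "[int (k * m) = - 1 * c] (mod int N)" using cong_mult[OF k m] by simp
  then have "[int (k * m) = - c] (mod int N)" by simp
  from power_mod_eqI[OF this] show ?thesis
    by (simp add: power_mod_eqI[OF m] power_mod_eqI[OF k] antipode_power antipode_g
        flip: power_mult)
qed

subsection \<open>Characters\<close>

text \<open>
  The images of \<open>x\<close> and \<open>y\<close> are nilpotent elements of a field.
\<close>

lemma character_vanishes:
  assumes "algebra_character sc \<gamma>"
  shows "\<gamma> x = 0" "\<gamma> y = 0"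
proof -
  note \<gamma> = algebra_homD[OF assms[unfolded algebra_character_iff_hom]]
  have "\<gamma> x ^ Nx = 0" "\<gamma> y ^ Ny = 0"
    using \<gamma>(5)[of x Nx] \<gamma>(5)[of y Ny] relations \<gamma>(6) by simp_all
  then show "\<gamma> x = 0" "\<gamma> y = 0" by simp_all
qed

lemma character_eqI:
  assumes "algebra_character sc \<gamma>" "algebra_character sc \<delta>" "\<gamma> g = \<delta> g"
  shows "\<gamma> = \<delta>"
  using assms(1,2)[unfolded algebra_character_iff_hom] assms(3)
  by (rule hom_eqI) (simp_all add: character_vanishes[OF assms(1)] character_vanishes[OF assms(2)])

lemma character_exists: "\<exists>\<gamma>. algebra_character sc \<gamma> \<and> \<gamma> g = q powi e"
proof -
  have "(q powi e) ^ N = 1"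
    by (rule powi_power_N)
  then obtain \<gamma> where "algebra_hom sc (*) \<gamma>" "\<gamma> g = q powi e"
    using hom_exists[OF algebra_over_field_self, of 0 0 "q powi e"] Nx_Ny_ge_2 by auto
  then show ?thesis by (auto simp: algebra_character_iff_hom)
qed

lemma character_root:
  assumes "algebra_character sc \<gamma>"
  obtains e where "\<gamma> g = q powi e"
proof -
  note \<gamma> = algebra_homD[OF assms[unfolded algebra_character_iff_hom]]
  have "\<gamma> g ^ N = 1" using \<gamma>(5)[of g N] by (simp add: relations \<gamma>(1))
  then obtain e where "\<gamma> g = q ^ e" by (rule primitive_root_generates[OF primitive_root])
  then show thesis by (intro that[of "int e"]) simp
qed

lemma character_power_mod:
  assumes "algebra_character sc \<gamma>" "\<gamma> g = q powi e"
  shows "\<gamma> (G c) = q powi (e * c)"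
proof -
  obtain m where m: "[int m = c] (mod int N)" using power_mod_exponent by blast
  have "\<gamma> (g ^ m) = q powi (e * int m)"
    by (simp add: algebra_homD(5)[OF assms(1)[unfolded algebra_character_iff_hom]] assms(2)
        power_int_power')
  also have "\<dots> = q powi (e * c)" using m by (simp add: q_powi_eq_iff cong_mult)
  finally show ?thesis by (simp add: power_mod_eqI[OF m])
qed

text \<open>
  The characters form a cyclic group under convolution, generated by the character \<open>\<kappa>\<close> with
  \<open>\<kappa> g = q\<close>, and evaluation at the group-like element \<open>l\<close> is a homomorphism from this group to the
  \<open>N\<close>-th roots of unity. The exponent \<open>d\<close> is read off from \<open>\<kappa> l\<close>. Thus \<open>l\<close> looks like \<open>g\<^sup>d\<close> to all
  characters.
\<close>

lemma grouplike_character_values: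
  assumes "grouplike sc \<Delta> \<epsilon> l" "l * l' = 1"
  obtains d where "\<And>\<gamma> e. algebra_character sc \<gamma> \<Longrightarrow> \<gamma> g = q powi e \<Longrightarrow> \<gamma> l = q powi (d * e)"
proof -
  have l: "tensor_eq sc (\<Delta> l) [(l, l)]" using assms by (simp add: grouplike_def)
  have mult: "\<eta> l = \<gamma> l * \<delta> l"
    if "algebra_character sc \<gamma>" "algebra_character sc \<delta>" "algebra_character sc \<eta>" "\<eta> g = \<gamma> g * \<delta> g"
    for \<gamma> \<delta> \<eta>
  proof -
    have "(\<lambda>h. \<Sum>(h1, h2)\<leftarrow>\<Delta> h. \<gamma> h1 * \<delta> h2) = \<eta>"
      using that character_convolution_grouplike[OF _ _ comult_g]
      by (intro character_eqI character_convolution) auto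
    then show ?thesis
      using character_convolution_grouplike[OF that(1,2) l] by (auto simp: fun_eq_iff)
  qed
  obtain \<kappa> where \<kappa>: "algebra_character sc \<kappa>" "\<kappa> g = q powi 1" using character_exists by blast
  have power: "\<gamma> l = \<kappa> l ^ m" if "algebra_character sc \<gamma>" "\<gamma> g = q powi (int m)" for \<gamma> m
    using that
  proof (induction m arbitrary: \<gamma>)
    case 0
    note \<gamma> = algebra_homD[OF 0(1)[unfolded algebra_character_iff_hom]]
    \<comment> \<open>an idempotent value, which is not 0 because \<open>l\<close> is invertible\<close>
    have "\<gamma> l * \<gamma> l = \<gamma> l" using mult[OF 0(1) 0(1) 0(1)] 0(2) by simp
    moreover have "\<gamma> l * \<gamma> l' = 1" using \<gamma>(2)[of l l'] \<gamma>(1) by (simp add: assms)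
    ultimately show ?case by (metis mult_cancel_left1 mult_zero_left power_0 zero_neq_one)
  next
    case (Suc m)
    obtain \<delta> where \<delta>: "algebra_character sc \<delta>" "\<delta> g = q powi (int m)" using character_exists by blast
    have "\<gamma> g = \<kappa> g * \<delta> g"
      using Suc.prems(2) \<kappa>(2) \<delta>(2) by (simp only: power_int_of_nat power_Suc power_int_1_right)
    then have "\<gamma> l = \<kappa> l * \<delta> l" by (rule mult[OF \<kappa>(1) \<delta>(1) Suc.prems(1)])
    then show ?case using Suc.IH[OF \<delta>] by simp
  qed
  obtain \<delta> where \<delta>: "algebra_character sc \<delta>" "\<delta> g = q powi (int 0)" using character_exists by blast
  have "\<kappa> l ^ N = 1"
    using power[OF \<delta>] power[OF \<delta>(1), of N] \<delta>(2) q_power_N by simp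
  then obtain d where d: "\<kappa> l = q ^ d" by (rule primitive_root_generates[OF primitive_root])
  show thesis
  proof (rule that)
    fix \<gamma> e assume \<gamma>: "algebra_character sc \<gamma>" "\<gamma> g = q powi e"
    obtain m where m: "[int m = e] (mod int N)" using power_mod_exponent by blast
    then have "q powi e = q powi (int m)" unfolding q_powi_eq_iff by (rule cong_sym)
    with \<gamma>(2) have "\<gamma> g = q powi (int m)" by (rule trans)
    from power[OF \<gamma>(1) this] have "\<gamma> l = q powi (int d * int m)"
      by (simp add: d power_mult flip: of_nat_mult)
    also have "\<dots> = q powi (int d * e)" using m by (simp add: q_powi_eq_iff cong_mult)
    finally show "\<gamma> l = q powi (int d * e)" .
  qed
qed

subsection \<open>The generators x and y\<close>

text \<open>
  The properties shared by \<open>x\<close>, with \<open>(c, b) = (a\<^sub>1\<^sub>1, a\<^sub>1\<^sub>2)\<close>, and \<open>y\<close>, with \<open>(c, b) = (a\<^sub>2\<^sub>1, a\<^sub>2\<^sub>2)\<close>, on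
  which the computations with them rest. The last one is the representation in which the
  generator acts as the off-diagonal matrix unit; it detects that the generator is not zero.
\<close>

definition skew_generator :: "int \<Rightarrow> int \<Rightarrow> 'h \<Rightarrow> bool" where
  "skew_generator c b z \<longleftrightarrow>
     tensor_eq sc (\<Delta> z) [(1, z), (z, G c)] \<and> S z = - (z * G (- c)) \<and>
     g * z = sc (q powi b) (z * g) \<and> (\<forall>\<gamma>. algebra_character sc \<gamma> \<longrightarrow> \<gamma> z = 0) \<and>
     (\<exists>\<Phi>. algebra_hom sc lower_triangular_scale \<Phi> \<and> \<Phi> g = LT 1 (q powi b) 0 \<and> \<Phi> z = LT 0 0 1)"

lemma skew_generator_x: "skew_generator (a$1$1) (a$1$2) x"
proof -
  let ?g = "LT 1 (q powi (a$1$2)) 0" and ?E = "LT 0 0 (1 :: 'k)"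
  have root: "(q powi (a$1$2)) ^ N = 1"
    by (rule powi_power_N)
  obtain \<Phi> where "algebra_hom sc lower_triangular_scale \<Phi>" "\<Phi> g = ?g" "\<Phi> x = ?E"
  proof (rule hom_exists[OF algebra_over_field_lower_triangular, where g' = ?g and x' = ?E and y' = 0])
    show "?E ^ Nx = 0" "(0 :: 'k lower_triangular) ^ Ny = 0"
      using Nx_Ny_ge_2 by (simp_all add: lower_triangular_corner_power power_0_left)
    show "?g ^ N = 1"
      using root by (simp add: lower_triangular_diagonal_power one_lower_triangular_def)
  qed (simp_all add: that)
  then show ?thesis
    using comult_x antipode_x relations character_vanishes unfolding skew_generator_def by blast
qed

lemma skew_generator_y: "skew_generator (a$2$1) (a$2$2) y"
proof -
  let ?g = "LT 1 (q powi (a$2$2)) 0" and ?E = "LT 0 0 (1 :: 'k)"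
  have root: "(q powi (a$2$2)) ^ N = 1"
    by (rule powi_power_N)
  obtain \<Phi> where "algebra_hom sc lower_triangular_scale \<Phi>" "\<Phi> g = ?g" "\<Phi> y = ?E"
  proof (rule hom_exists[OF algebra_over_field_lower_triangular, where g' = ?g and x' = 0 and y' = ?E])
    show "(0 :: 'k lower_triangular) ^ Nx = 0" "?E ^ Ny = 0"
      using Nx_Ny_ge_2 by (simp_all add: lower_triangular_corner_power power_0_left)
    show "?g ^ N = 1"
      using root by (simp add: lower_triangular_diagonal_power one_lower_triangular_def)
  qed (simp_all add: that)
  then show ?thesis
    using comult_y antipode_y relations character_vanishes unfolding skew_generator_def by blast
qed

text \<open>
  \<open>S\<^sup>2\<close> is conjugation by \<open>g\<^sup>c\<close> on the generator.
\<close>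

lemma antipode_square_skew_generator:
  assumes "skew_generator c b z"
  shows "S (S z) = sc (q powi (c * b)) z"
proof -
  have z: "S z = - (z * G (- c))" "g * z = sc (q powi b) (z * g)"
    using assms by (auto simp: skew_generator_def)
  have "S (S z) = G c * z * G (- c)"
    by (simp add: z(1) antipode_minus antipode_mult antipode_power_mod mult.assoc)
  also have "\<dots> = sc (q powi (c * b)) (z * (G c * G (- c)))"
    by (simp add: power_mod_commute[OF z(2)] scale_mult mult.assoc mult.commute)
  finally show ?thesis by (simp add: power_mod_inverse)
qed

text \<open>
  Of the two twists only the right one acts on the generator, by the value of \<open>\<beta>\<close> at \<open>g\<^sup>c\<close>.
\<close>

lemma twisted_conjugation_skew_generator:
  assumes "skew_generator c b z" "algebra_character sc \<beta>" "\<beta> g = q powi e"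
  shows "l * left_twist (\<beta> \<circ> S) (right_twist \<beta> z) * l' = sc (q powi (e * c)) (l * z * l')"
proof -
  have char: "algebra_character sc (\<beta> \<circ> S)" by (rule character_antipode[OF assms(2)])
  have z: "tensor_eq sc (\<Delta> z) [(1, z), (z, G c)]" and "\<beta> z = 0" "(\<beta> \<circ> S) z = 0"
    using assms(1,2) char by (auto simp: skew_generator_def)
  then show ?thesis
    using algebra_homD(4)[OF algebra_hom_twists(1)[OF char]]
    by (simp add: twists_skew_primitive[OF assms(2) z] twists_skew_primitive[OF char z]
        character_power_mod[OF assms(2,3)] scale_mult)
qed

lemma twisted_conjugation_g:
  assumes "algebra_character sc \<beta>"
  shows "left_twist (\<beta> \<circ> S) (right_twist \<beta> g) = g"
proof -
  have char: "algebra_character sc (\<beta> \<circ> S)" by (rule character_antipode[OF assms])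
  note \<beta> = algebra_homD[OF assms[unfolded algebra_character_iff_hom]]
  have "\<beta> g * \<beta> (S g) = \<beta> (G 1 * G (- 1))" by (simp add: \<beta>(2) antipode_g power_mod_1)
  then have "\<beta> g * \<beta> (S g) = 1" by (simp only: power_mod_inverse \<beta>(1))
  then show ?thesis
    using algebra_homD(4)[OF algebra_hom_twists(1)[OF char]]
    by (simp add: twists_grouplike[OF assms comult_g] twists_grouplike[OF char comult_g])
qed

text \<open>
  If conjugation by \<open>l\<close> scales the generator, then by the same factor as conjugation by \<open>g\<^sup>d\<close>. In the lower triangular
  representation \<open>\<Phi>\<close> the corner entry of \<open>z l\<close> is the upper diagonal entry of \<open>\<Phi> l\<close>, and that of
  \<open>l z\<close> is the lower one. Both diagonal entries are characters, with exponents \<open>0\<close> and \<open>b\<close>, so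
  their values at \<open>l\<close> are known.
\<close>

lemma skew_generator_conjugation_weight:
  assumes "skew_generator c b z" "l' * l = 1"
    and vals: "\<And>\<gamma> e. algebra_character sc \<gamma> \<Longrightarrow> \<gamma> g = q powi e \<Longrightarrow> \<gamma> l = q powi (d * e)"
    and eq: "sc (q powi s) z = sc (q powi t) (l * z * l')"
  shows "[t + d * b = s] (mod int N)"
proof -
  obtain \<Phi> where \<Phi>: "algebra_hom sc lower_triangular_scale \<Phi>" "\<Phi> g = LT 1 (q powi b) 0"
    "\<Phi> z = LT 0 0 1"
    using assms(1) by (auto simp: skew_generator_def)
  have "sc (q powi s) (z * l) = sc (q powi s) z * l" by (simp add: scale_mult)
  also have "\<dots> = sc (q powi t) (l * z * (l' * l))" by (simp only: eq scale_mult mult.assoc)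
  finally have "\<Phi> (sc (q powi s) (z * l)) = \<Phi> (sc (q powi t) (l * z))" by (simp add: assms(2))
  then have "lower_triangular_scale (q powi s) (\<Phi> z * \<Phi> l) =
      lower_triangular_scale (q powi t) (\<Phi> l * \<Phi> z)"
    by (simp add: algebra_homD[OF \<Phi>(1)])
  then have "q powi s * upper_diagonal (\<Phi> l) = q powi t * lower_diagonal (\<Phi> l)"
    by (cases "\<Phi> l") (simp add: \<Phi>(3))
  moreover have "upper_diagonal (\<Phi> l) = q powi (d * 0)" "lower_diagonal (\<Phi> l) = q powi (d * b)"
    using vals[OF algebra_hom_diagonals(1)[OF \<Phi>(1)], of 0]
      vals[OF algebra_hom_diagonals(2)[OF \<Phi>(1)], of b] by (simp_all add: \<Phi>(2))
  ultimately have "q powi (t + d * b) = q powi s" by (simp add: power_int_add q_nonzero)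
  then show ?thesis by (simp add: q_powi_eq_iff)
qed

text \<open>
  The unknowns are the exponents of \<open>\<beta> g = q\<^sup>e\<close> and of the power \<open>g\<^sup>d\<close> that \<open>l\<close> resembles;
  conversely such exponents give the pair \<open>(g\<^sup>d, \<beta>)\<close>. The generator \<open>g\<close> imposes no condition.
\<close>

proposition pair_in_involution_exists_iff:
  "(\<exists>l \<beta>. pair_in_involution sc \<Delta> \<epsilon> S l \<beta>) \<longleftrightarrow>
   (\<exists>e d. [e * a$1$1 + d * a$1$2 = a$1$1 * a$1$2] (mod int N) \<and>
      [e * a$2$1 + d * a$2$2 = a$2$1 * a$2$2] (mod int N))"
proof
  assume "\<exists>l \<beta>. pair_in_involution sc \<Delta> \<epsilon> S l \<beta>"
  then obtain l \<beta> l' where l: "grouplike sc \<Delta> \<epsilon> l" "l * l' = 1" "l' * l = 1"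
    and \<beta>: "algebra_character sc \<beta>"
    and eq: "\<And>h. S (S h) = l * left_twist (\<beta> \<circ> S) (right_twist \<beta> h) * l'"
    unfolding pair_in_involution_iff by blast
  obtain e where e: "\<beta> g = q powi e" by (rule character_root[OF \<beta>])
  obtain d where d: "\<And>\<gamma> e. algebra_character sc \<gamma> \<Longrightarrow> \<gamma> g = q powi e \<Longrightarrow> \<gamma> l = q powi (d * e)"
    using grouplike_character_values[OF l(1,2)] by blast
  have "[e * c + d * b = c * b] (mod int N)" if "skew_generator c b z" for c b z
  proof (rule skew_generator_conjugation_weight[OF that l(3)])
    show "sc (q powi (c * b)) z = sc (q powi (e * c)) (l * z * l')"
      using eq[of z] by (simp only: antipode_square_skew_generator[OF that]
          twisted_conjugation_skew_generator[OF that \<beta> e])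
  qed (rule d)
  from this[OF skew_generator_x] this[OF skew_generator_y]
  show "\<exists>e d. [e * a$1$1 + d * a$1$2 = a$1$1 * a$1$2] (mod int N) \<and>
      [e * a$2$1 + d * a$2$2 = a$2$1 * a$2$2] (mod int N)" by blast
next
  assume "\<exists>e d. [e * a$1$1 + d * a$1$2 = a$1$1 * a$1$2] (mod int N) \<and>
      [e * a$2$1 + d * a$2$2 = a$2$1 * a$2$2] (mod int N)"
  then obtain e d where xy: "[e * a$1$1 + d * a$1$2 = a$1$1 * a$1$2] (mod int N)"
      "[e * a$2$1 + d * a$2$2 = a$2$1 * a$2$2] (mod int N)" by blast
  obtain \<beta> where \<beta>: "algebra_character sc \<beta>" "\<beta> g = q powi e" using character_exists by blast
  let ?R = "\<lambda>h. G d * left_twist (\<beta> \<circ> S) (right_twist \<beta> h) * G (- d)"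
  have skew: "S (S z) = ?R z"
    if z: "skew_generator c b z" and cb: "[e * c + d * b = c * b] (mod int N)" for c b z
  proof -
    have "g * z = sc (q powi b) (z * g)" using z by (simp add: skew_generator_def)
    from power_mod_commute[OF this]
    have "G d * z * G (- d) = sc (q powi (b * d)) (z * (G d * G (- d)))"
      by (simp add: scale_mult mult.assoc)
    then have "?R z = sc (q powi (e * c + d * b)) z"
      by (simp add: twisted_conjugation_skew_generator[OF z \<beta>] power_mod_inverse power_int_add
          q_nonzero mult.commute)
    also have "q powi (e * c + d * b) = q powi (c * b)" using cb by (simp add: q_powi_eq_iff)
    finally show ?thesis by (simp only: antipode_square_skew_generator[OF z])
  qed
  have "S (S g) = g"
    by (simp add: antipode_g antipode_power_mod power_mod_1)
  moreover have "?R g = g"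
  proof -
    have "?R g = G d * G 1 * G (- d)"
      by (simp only: twisted_conjugation_g[OF \<beta>(1)] power_mod_1)
    also have "\<dots> = G (d + 1 + - d)" by (simp only: power_mod_add)
    finally show ?thesis by (simp add: power_mod_1)
  qed
  ultimately have "(\<lambda>h. S (S h)) = ?R"
    by (intro hom_eqI[OF algebra_hom_antipode_square] skew[OF skew_generator_x xy(1)]
        skew[OF skew_generator_y xy(2)] algebra_hom_twisted_conjugation[OF \<beta>(1)]
        power_mod_inverse) (simp only:)
  then have "\<forall>h. S (S h) = ?R h" unfolding fun_eq_iff .
  then have "pair_in_involution sc \<Delta> \<epsilon> S (G d) \<beta>"
    unfolding pair_in_involution_iff
    using grouplike_power_mod \<beta>(1) power_mod_inverse by blast
  then show "\<exists>l \<beta>. pair_in_involution sc \<Delta> \<epsilon> S l \<beta>" by blast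
qed

end

section \<open>The congruence system modulo N\<close>

text \<open>
  Here \<open>A, B, C, D\<close> stand for \<open>a\<^sub>1\<^sub>1, a\<^sub>1\<^sub>2, a\<^sub>2\<^sub>1, a\<^sub>2\<^sub>2\<close>. Exchanging the rows or the columns of the
  matrix permutes the equations or the unknowns, which is used to move the entry of least
  valuation to the upper left.
\<close>

definition solvable_mod :: "nat \<Rightarrow> int \<Rightarrow> int \<Rightarrow> int \<Rightarrow> int \<Rightarrow> bool" where
  "solvable_mod m A B C D \<longleftrightarrow>
     (\<exists>e d. [e * A + d * B = A * B] (mod int m) \<and> [e * C + d * D = C * D] (mod int m))"

lemma solvable_mod_cong:
  assumes "[A = A'] (mod int m)" "[B = B'] (mod int m)" "[C = C'] (mod int m)" "[D = D'] (mod int m)"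
  shows "solvable_mod m A B C D \<longleftrightarrow> solvable_mod m A' B' C' D'"
proof -
  have "[e * A + d * B = A * B] (mod int m) \<longleftrightarrow> [e * A' + d * B' = A' * B'] (mod int m)"
    if "[A = A'] (mod int m)" "[B = B'] (mod int m)" for e d A A' B B'
  proof -
    have "[e * A + d * B = e * A' + d * B'] (mod int m)" "[A * B = A' * B'] (mod int m)"
      by (intro cong_add cong_mult cong_refl that)+
    then show ?thesis by (meson cong_sym cong_trans)
  qed
  from this[OF assms(1,2)] this[OF assms(3,4)] show ?thesis
    by (simp add: solvable_mod_def)
qed

lemma solvable_mod_swap_rows: "solvable_mod m A B C D \<longleftrightarrow> solvable_mod m C D A B"
  by (auto simp: solvable_mod_def)

lemma solvable_mod_swap_columns: "solvable_mod m A B C D \<longleftrightarrow> solvable_mod m B A D C"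
proof -
  have "solvable_mod m B A D C" if solvable: "solvable_mod m A B C D" for A B C D
  proof -
    obtain e d where "[e * A + d * B = A * B] (mod int m)" "[e * C + d * D = C * D] (mod int m)"
      using solvable unfolding solvable_mod_def by blast
    then have "[d * B + e * A = B * A] (mod int m)" "[d * D + e * C = D * C] (mod int m)"
      by (simp_all add: ac_simps)
    then show ?thesis unfolding solvable_mod_def by blast
  qed
  then show ?thesis by blast
qed

lemma solvable_mod_coprime_product:
  assumes "coprime m k"
  shows "solvable_mod (m * k) A B C D \<longleftrightarrow> solvable_mod m A B C D \<and> solvable_mod k A B C D"
proof
  assume "solvable_mod (m * k) A B C D"
  then show "solvable_mod m A B C D \<and> solvable_mod k A B C D"
    unfolding solvable_mod_def of_nat_mult cong_iff_dvd_diff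
    by (blast intro: dvd_mult_left dvd_mult_right)
next
  assume "solvable_mod m A B C D \<and> solvable_mod k A B C D"
  then obtain e d e' d' where
    m: "[e * A + d * B = A * B] (mod int m)" "[e * C + d * D = C * D] (mod int m)" and
    k: "[e' * A + d' * B = A * B] (mod int k)" "[e' * C + d' * D = C * D] (mod int k)"
    by (auto simp: solvable_mod_def)
  have cop: "coprime (int m) (int k)" using assms by simp
  obtain E where E: "[E = e] (mod int m)" "[E = e'] (mod int k)"
    using binary_chinese_remainder_int[OF cop] by blast
  obtain F where F: "[F = d] (mod int m)" "[F = d'] (mod int k)"
    using binary_chinese_remainder_int[OF cop] by blast
  have "[E * U + F * V = e * U + d * V] (mod int m)" "[E * U + F * V = e' * U + d' * V] (mod int k)" for U V
    using E F by (auto intro!: cong_add cong_mult)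
  then have "[E * A + F * B = A * B] (mod int m)" "[E * C + F * D = C * D] (mod int m)"
    "[E * A + F * B = A * B] (mod int k)" "[E * C + F * D = C * D] (mod int k)"
    using m k by (meson cong_trans)+
  then have "[E * A + F * B = A * B] (mod int (m * k))" "[E * C + F * D = C * D] (mod int (m * k))"
    using coprime_cong_mult[OF _ _ cop] by auto
  then show "solvable_mod (m * k) A B C D" by (auto simp: solvable_mod_def)
qed

text \<open>
  With \<open>h\<close> the inverse of 2, the solution is \<open>e = h (B + D)\<close>, \<open>d = h (A + C)\<close>: substituting it,
  the error in both equations is half of \<open>A D + B C\<close>.
\<close>

lemma solvable_mod_odd:
  assumes "odd m" "[A * D + B * C = 0] (mod int m)"
  shows "solvable_mod m A B C D"
proof -
  have "coprime 2 (int m)" using assms(1) by simp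
  then obtain h where h: "[2 * h = 1] (mod int m)" using cong_solve_coprime_int by blast
  then obtain t where t: "2 * h = 1 + int m * t" 
    by (metis cong_iff_dvd_diff diff_add_cancel add.commute dvdE)
  obtain s where s: "A * D + B * C = int m * s"
    using assms(2) by (auto simp: cong_0_iff elim: dvdE)
  have "h * (B + D) * A + h * (A + C) * B - A * B = (2 * h - 1) * (A * B) + h * (A * D + B * C)"
    by algebra
  then have 1: "int m dvd h * (B + D) * A + h * (A + C) * B - A * B"
    by (simp add: t s)
  have "h * (B + D) * C + h * (A + C) * D - C * D = (2 * h - 1) * (C * D) + h * (A * D + B * C)"
    by algebra
  then have 2: "int m dvd h * (B + D) * C + h * (A + C) * D - C * D"
    by (simp add: t s)
  from 1 2 show ?thesis
    unfolding solvable_mod_def cong_iff_dvd_diff by blast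
qed

text \<open>
  The solution is \<open>e = B + D\<close>, \<open>d = 0\<close>.
\<close>

lemma solvable_mod_of_vanishing_diagonals:
  assumes "[A * D = 0] (mod int m)" "[B * C = 0] (mod int m)"
  shows "solvable_mod m A B C D"
proof -
  have "[(B + D) * A + 0 * B = A * B] (mod int m)" "[(B + D) * C + 0 * D = C * D] (mod int m)"
    using assms by (auto simp: cong_iff_dvd_diff algebra_simps)
  then show ?thesis unfolding solvable_mod_def by blast
qed

text \<open>
  Divide by the power of 2 and invert the odd factor.
\<close>

lemma linear_congruence_pow2:
  fixes R u :: int
  assumes "odd u" "2 ^ v dvd R"
  obtains f where "2 ^ k dvd 2 ^ v * u * f - R"
proof -
  obtain R' where R: "R = 2 ^ v * R'" using assms(2) by (auto elim: dvdE)
  have "coprime u (2 ^ k)" using assms(1) by simp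
  then obtain w where w: "[u * w = 1] (mod 2 ^ k)" using cong_solve_coprime_int by blast
  then have "2 ^ k dvd u * w - 1" by (simp add: cong_iff_dvd_diff)
  then have "2 ^ k dvd 2 ^ v * R' * (u * w - 1)" by simp
  then have "2 ^ k dvd 2 ^ v * u * (w * R') - R" by (simp add: R algebra_simps)
  then show thesis by (rule that)
qed

lemma odd_part_int:
  fixes c :: int
  assumes "c \<noteq> 0"
  obtains v u where "c = 2 ^ v * u" "odd u"
  using assms by (elim multiplicity_decompose'[of c 2]) auto

text \<open>
  Since \<open>\<alpha>\<close> is minimal, the first equation can be solved for \<open>e\<close>, given any \<open>f\<close>. Substituting in
  the second one and using \<open>b c = - a d\<close> modulo \<open>2\<^sup>r\<close>, where \<open>r = n - (\<alpha> + \<delta>)\<close>, one is left with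
  \<open>(a d - b c) f = R\<close> modulo \<open>2\<close> to the power \<open>\<alpha> + r\<close>, where \<open>R = a d (2\<^sup>\<gamma> c + 2\<^sup>\<alpha> a)\<close>.
  
  If \<open>\<alpha> < \<gamma>\<close>, then \<open>R\<close> has valuation exactly \<open>\<alpha>\<close>, which is smaller than the exponent of the modulus;
  so the congruence is solvable if and only if the valuation of \<open>a d - b c\<close> is at most \<open>\<alpha>\<close>.
  
  If \<open>\<alpha> = \<gamma>\<close>, then \<open>R\<close> is divisible by \<open>2\<close> to the power \<open>\<alpha> + 1\<close>. For \<open>r = 1\<close> this means that \<open>f = 0\<close> is
  a solution. For \<open>r \<ge> 2\<close> the determinant is \<open>2 a d\<close> modulo 4, so its valuation is 1 and it
  divides the even number \<open>R\<close> up to an odd factor.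
\<close>

lemma solvable_mod_pow2_core:
  fixes a b c d :: int and \<alpha> \<beta> \<gamma> \<delta> n :: nat
  assumes odd: "odd a" "odd b" "odd c" "odd d"
    and sum: "\<alpha> + \<delta> = \<beta> + \<gamma>" and less: "\<alpha> + \<delta> < n"
    and min: "\<alpha> \<le> \<beta>" "\<alpha> \<le> \<gamma>"
    and param: "2 ^ n dvd 2 ^ (\<alpha> + \<delta>) * (a * d + b * c)"
  shows "solvable_mod (2 ^ n) (2 ^ \<alpha> * a) (2 ^ \<beta> * b) (2 ^ \<gamma> * c) (2 ^ \<delta> * d) \<longleftrightarrow>
    \<alpha> = \<gamma> \<or> \<not> 2 ^ (\<alpha> + 1) dvd a * d - b * c"
proof -
  define p q where "p = \<beta> - \<alpha>" and "q = \<gamma> - \<alpha>"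
  define r where "r = n - (\<alpha> + \<delta>)"
  have exps: "\<beta> = \<alpha> + p" "\<gamma> = \<alpha> + q" "\<delta> = \<alpha> + p + q" "n = \<delta> + (\<alpha> + r)" "r > 0"
    using sum less min by (auto simp: p_def q_def r_def)
  have "2 ^ (\<alpha> + \<delta>) * 2 ^ r dvd 2 ^ (\<alpha> + \<delta>) * (a * d + b * c)"
    using param exps by (simp add: power_add mult_ac)
  then have param': "2 ^ r dvd a * d + b * c" by simp
  define R where "R = a * d * (2 ^ \<gamma> * c + 2 ^ \<alpha> * a)"
  \<comment> \<open>\<open>c 2\<^sup>q\<close> times the first equation minus \<open>a\<close> times the second eliminates \<open>e\<close>\<close>
  have key: "c * 2 ^ q * (e * (2 ^ \<alpha> * a) + f * (2 ^ \<beta> * b) - 2 ^ \<alpha> * a * (2 ^ \<beta> * b))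
      - a * (e * (2 ^ \<gamma> * c) + f * (2 ^ \<delta> * d) - 2 ^ \<gamma> * c * (2 ^ \<delta> * d))
      = - (2 ^ \<delta> * ((a * d - b * c) * f - R)) - 2 ^ \<delta> * 2 ^ \<alpha> * a * (a * d + b * c)" 
      (is "c * 2 ^ q * ?E1 - a * ?E2 = _") for e f
    unfolding R_def exps power_add by algebra
  have cancel_left: "m dvd Y" if "m dvd X - Y" "m dvd X" for m X Y :: int
    using dvd_diff[OF that(2) that(1)] by simp
  show ?thesis
  proof
    assume "solvable_mod (2 ^ n) (2 ^ \<alpha> * a) (2 ^ \<beta> * b) (2 ^ \<gamma> * c) (2 ^ \<delta> * d)"
    then obtain e f where
      e1: "2 ^ n dvd e * (2 ^ \<alpha> * a) + f * (2 ^ \<beta> * b) - 2 ^ \<alpha> * a * (2 ^ \<beta> * b)" and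
      e2: "2 ^ n dvd e * (2 ^ \<gamma> * c) + f * (2 ^ \<delta> * d) - 2 ^ \<gamma> * c * (2 ^ \<delta> * d)"
      by (auto simp: solvable_mod_def cong_iff_dvd_diff)
    have cancel: "m dvd - Y - Z \<Longrightarrow> m dvd Z \<Longrightarrow> m dvd Y" for m Y Z :: int
      using dvd_add[of m "- Y - Z" Z] by simp
    have "2 ^ n dvd 2 ^ \<delta> * ((a * d - b * c) * f - R)"
    proof -
      have "(2::int) ^ n dvd 2 ^ \<delta> * 2 ^ \<alpha> * a * (a * d + b * c)"
        using mult_dvd_mono[OF dvd_refl[of "2 ^ \<delta> * 2 ^ \<alpha>"] dvd_mult[OF param', of a]]
        by (simp add: exps(4) power_add mult_ac)
      moreover have "2 ^ n dvd - (2 ^ \<delta> * ((a * d - b * c) * f - R)) - 2 ^ \<delta> * 2 ^ \<alpha> * a * (a * d + b * c)"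
        using dvd_diff[OF dvd_mult[OF e1, of "c * 2 ^ q"] dvd_mult[OF e2, of a]]
        unfolding key .
      ultimately show ?thesis by (rule cancel[rotated])
    qed
    then have det: "2 ^ (\<alpha> + r) dvd (a * d - b * c) * f - R"
      unfolding exps(4) power_add[of 2 \<delta>] by simp
    show "\<alpha> = \<gamma> \<or> \<not> 2 ^ (\<alpha> + 1) dvd a * d - b * c"
    proof (rule ccontr)
      assume "\<not> ?thesis"
      then have "q > 0" and dvd: "2 ^ (\<alpha> + 1) dvd a * d - b * c" using exps by auto
      have "(2::int) ^ (\<alpha> + 1) dvd 2 ^ (\<alpha> + r)" using exps(5) by (intro le_imp_power_dvd) simp
      then have "2 ^ (\<alpha> + 1) dvd (a * d - b * c) * f - R" using det dvd_trans by blast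
      then have "2 ^ (\<alpha> + 1) dvd R" 
        by (rule cancel_left) (rule dvd_mult2[OF dvd])
      also have "R = 2 ^ \<alpha> * (a * d * (2 ^ q * c + a))" by (simp add: R_def exps power_add algebra_simps)
      finally have "even (a * d * (2 ^ q * c + a))" by simp
      then show False using odd \<open>q > 0\<close> by simp
    qed
  next
    assume alt: "\<alpha> = \<gamma> \<or> \<not> 2 ^ (\<alpha> + 1) dvd a * d - b * c"
    obtain f where f: "2 ^ (\<alpha> + r) dvd (a * d - b * c) * f - R"
    proof (cases "2 ^ (\<alpha> + 1) dvd a * d - b * c")
      case False
      then have "a * d - b * c \<noteq> 0" by auto
      then obtain v u where vu: "a * d - b * c = 2 ^ v * u" "odd u" by (rule odd_part_int)
      have "v \<le> \<alpha>"
      proof (rule ccontr)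
        assume "\<not> v \<le> \<alpha>"
        then have "(2::int) ^ (\<alpha> + 1) dvd 2 ^ v" by (intro le_imp_power_dvd) simp
        then show False using False vu by (metis dvd_mult2)
      qed
      then have "(2::int) ^ v dvd 2 ^ \<alpha>" by (rule le_imp_power_dvd)
      moreover have "2 ^ \<alpha> dvd R" by (simp add: R_def exps power_add)
      ultimately have "2 ^ v dvd R" by (rule dvd_trans)
      from linear_congruence_pow2[OF vu(2) this] show thesis
        using that unfolding vu(1) by blast
    next
      case True
      then have q: "q = 0" using alt exps by simp
      have R: "R = 2 ^ \<alpha> * (a * d * (c + a))" by (simp add: R_def exps q algebra_simps)
      have even: "even (a * d * (c + a))" using odd by simp
      show thesis
      proof (cases "r = 1")
        case True
        then have "2 ^ (\<alpha> + r) dvd R" 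
          using mult_dvd_mono[OF dvd_refl even, of "2 ^ \<alpha>"] by (simp add: R mult.commute)
        then show thesis by (intro that[of 0]) simp
      next
        case False
        then have "(2::int) ^ 2 dvd 2 ^ r" using exps(5) by (intro le_imp_power_dvd) simp
        then have "4 dvd a * d + b * c" using param' by (auto dest: dvd_trans)
        moreover have "4 dvd P + Q \<Longrightarrow> odd P \<Longrightarrow> \<not> 4 dvd P - Q" for P Q :: int
          by presburger
        ultimately have "\<not> 4 dvd a * d - b * c" using odd by simp
        moreover have "even (a * d - b * c)" using odd by simp
        then obtain u where u: "a * d - b * c = 2 * u" by (rule dvdE)
        ultimately have "odd u" by auto
        have "2 ^ 1 dvd R" using even by (simp add: R)
        from linear_congruence_pow2[OF \<open>odd u\<close> this, of "\<alpha> + r"] show thesis using that u by auto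
      qed
    qed
    have "coprime a (2 ^ n)" using odd by simp
    then obtain a' where a': "[a * a' = 1] (mod 2 ^ n)" using cong_solve_coprime_int by blast
    then have a'': "2 ^ n dvd a * a' - 1" by (simp add: cong_iff_dvd_diff)
    \<comment> \<open>the first equation solved for \<open>e\<close>\<close>
    define e where "e = 2 ^ \<beta> * b - 2 ^ p * b * a' * f"
    have "e * (2 ^ \<alpha> * a) + f * (2 ^ \<beta> * b) - 2 ^ \<alpha> * a * (2 ^ \<beta> * b) = - (a * a' - 1) * (2 ^ \<beta> * b * f)"
      unfolding e_def exps power_add by algebra
    then have e1: "2 ^ n dvd e * (2 ^ \<alpha> * a) + f * (2 ^ \<beta> * b) - 2 ^ \<alpha> * a * (2 ^ \<beta> * b)"
      using a'' by (metis dvd_minus_iff dvd_mult2)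
    have "2 ^ n dvd - (2 ^ \<delta> * ((a * d - b * c) * f - R)) - 2 ^ \<delta> * 2 ^ \<alpha> * a * (a * d + b * c)"
    proof (rule dvd_diff)
      show "2 ^ n dvd - (2 ^ \<delta> * ((a * d - b * c) * f - R))"
        using f unfolding exps(4) power_add[of 2 \<delta>] by simp
      show "(2::int) ^ n dvd 2 ^ \<delta> * 2 ^ \<alpha> * a * (a * d + b * c)"
        using mult_dvd_mono[OF dvd_refl[of "2 ^ \<delta> * 2 ^ \<alpha>"] dvd_mult[OF param', of a]]
        by (simp add: exps(4) power_add mult_ac)
    qed
    then have "2 ^ n dvd c * 2 ^ q * (e * (2 ^ \<alpha> * a) + f * (2 ^ \<beta> * b) - 2 ^ \<alpha> * a * (2 ^ \<beta> * b))
      - a * (e * (2 ^ \<gamma> * c) + f * (2 ^ \<delta> * d) - 2 ^ \<gamma> * c * (2 ^ \<delta> * d))"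
      by (simp only: key)
    then have "2 ^ n dvd a * (e * (2 ^ \<gamma> * c) + f * (2 ^ \<delta> * d) - 2 ^ \<gamma> * c * (2 ^ \<delta> * d))"
      by (rule cancel_left) (rule dvd_mult[OF e1])
    then have "2 ^ n dvd e * (2 ^ \<gamma> * c) + f * (2 ^ \<delta> * d) - 2 ^ \<gamma> * c * (2 ^ \<delta> * d)"
      using \<open>coprime a (2 ^ n)\<close> by (simp add: coprime_dvd_mult_right_iff coprime_commute)
    with e1 show "solvable_mod (2 ^ n) (2 ^ \<alpha> * a) (2 ^ \<beta> * b) (2 ^ \<gamma> * c) (2 ^ \<delta> * d)"
      by (auto simp: solvable_mod_def cong_iff_dvd_diff)
  qed
qed

lemma pow2_dvd_odd_multiple_iff:
  fixes u :: int
  assumes "odd u"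
  shows "2 ^ k dvd 2 ^ v * u \<longleftrightarrow> k \<le> v"
proof
  assume dvd: "2 ^ k dvd 2 ^ v * u"
  show "k \<le> v"
  proof (rule ccontr)
    assume "\<not> k \<le> v"
    then have "(2::int) ^ Suc v dvd 2 ^ k" by (intro le_imp_power_dvd) simp
    then have "2 ^ v * 2 dvd 2 ^ v * u" using dvd unfolding power_Suc2 by (rule dvd_trans)
    then show False using assms by simp
  qed
qed (intro dvd_mult2 le_imp_power_dvd)

text \<open>
  If the exponents differed, the sum would have the valuation of the term with the smaller
  exponent, which is less than \<open>n\<close>. Applied to the relation \<open>a\<^sub>1\<^sub>1 a\<^sub>2\<^sub>2 + a\<^sub>1\<^sub>2 a\<^sub>2\<^sub>1 = 0\<close> this gives
  \<open>\<aa>\<^sub>1\<^sub>1 + \<aa>\<^sub>2\<^sub>2 = \<aa>\<^sub>1\<^sub>2 + \<aa>\<^sub>2\<^sub>1\<close>.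
\<close>

lemma pow2_sum_exponents_eq:
  fixes u w :: int
  assumes odd: "odd u" "odd w" and dvd: "2 ^ n dvd 2 ^ s * u + 2 ^ t * w" and "s < n"
  shows "t = s"
proof (rule ccontr)
  define r where "r = min s t"
  assume "t \<noteq> s"
  have "(2::int) ^ s = 2 ^ r * 2 ^ (s - r)" "(2::int) ^ t = 2 ^ r * 2 ^ (t - r)"
    by (simp_all add: r_def flip: power_add)
  then have "2 ^ s * u + 2 ^ t * w = 2 ^ r * (2 ^ (s - r) * u + 2 ^ (t - r) * w)"
    by (simp only: distrib_left mult.assoc)
  moreover have "(2::int) ^ Suc r dvd 2 ^ n"
    by (rule le_imp_power_dvd) (use \<open>s < n\<close> in \<open>simp add: r_def\<close>)
  ultimately have "2 ^ r * 2 dvd 2 ^ r * (2 ^ (s - r) * u + 2 ^ (t - r) * w)"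
    using dvd unfolding power_Suc2 by (metis dvd_trans)
  then have "even (2 ^ (s - r) * u + 2 ^ (t - r) * w)"
    by (simp only: dvd_mult_cancel_left) simp
  with odd \<open>t \<noteq> s\<close> show False
    by (auto simp: r_def min_def split: if_splits)
qed

text \<open>
  Swapping rows or columns only changes the sign of the determinant, and the condition on the
  exponents is insensitive to it: \<open>\<alpha> = \<gamma>\<close> if and only if \<open>\<beta> = \<delta>\<close>.
\<close>

lemma solvable_mod_pow2:
  fixes a b c d :: int and \<alpha> \<beta> \<gamma> \<delta> n :: nat
  assumes odd: "odd a" "odd b" "odd c" "odd d"
    and sum: "\<alpha> + \<delta> = \<beta> + \<gamma>" and less: "\<alpha> + \<delta> < n"
    and param: "2 ^ n dvd 2 ^ (\<alpha> + \<delta>) * (a * d + b * c)"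
  shows "solvable_mod (2 ^ n) (2 ^ \<alpha> * a) (2 ^ \<beta> * b) (2 ^ \<gamma> * c) (2 ^ \<delta> * d) \<longleftrightarrow>
    \<alpha> = \<gamma> \<or> \<not> 2 ^ (min (min \<alpha> \<beta>) (min \<gamma> \<delta>) + 1) dvd a * d - b * c"
    (is "?solvable \<longleftrightarrow> _ \<or> \<not> 2 ^ (?m + 1) dvd _")
proof -
  have flip: "2 ^ k dvd b * c - a * d \<longleftrightarrow> 2 ^ k dvd a * d - b * c" for k
    using dvd_minus_iff[of "2 ^ k" "a * d - b * c"] by simp
  consider "\<alpha> \<le> \<beta>" "\<alpha> \<le> \<gamma>" | "\<beta> \<le> \<alpha>" "\<beta> \<le> \<delta>" | "\<gamma> \<le> \<delta>" "\<gamma> \<le> \<alpha>" | "\<delta> \<le> \<gamma>" "\<delta> \<le> \<beta>"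
    using sum by linarith
  then show ?thesis
  proof cases
    case 1
    then have m: "?m = \<alpha>" using sum by simp
    show ?thesis
      unfolding m by (rule solvable_mod_pow2_core[OF odd sum less 1 param])
  next
    case 2
    then have m: "?m = \<beta>" "\<beta> = \<delta> \<longleftrightarrow> \<alpha> = \<gamma>" using sum by auto
    have "?solvable \<longleftrightarrow> solvable_mod (2 ^ n) (2 ^ \<beta> * b) (2 ^ \<alpha> * a) (2 ^ \<delta> * d) (2 ^ \<gamma> * c)"
      by (rule solvable_mod_swap_columns)
    also have "\<dots> \<longleftrightarrow> \<beta> = \<delta> \<or> \<not> 2 ^ (\<beta> + 1) dvd b * c - a * d"
      by (rule solvable_mod_pow2_core) (use odd sum less 2 param in \<open>auto simp: add.commute\<close>)
    finally show ?thesis by (simp only: m flip)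
  next
    case 3
    then have m: "?m = \<gamma>" using sum by auto
    have "?solvable \<longleftrightarrow> solvable_mod (2 ^ n) (2 ^ \<gamma> * c) (2 ^ \<delta> * d) (2 ^ \<alpha> * a) (2 ^ \<beta> * b)"
      by (rule solvable_mod_swap_rows)
    also have "\<dots> \<longleftrightarrow> \<gamma> = \<alpha> \<or> \<not> 2 ^ (\<gamma> + 1) dvd c * b - d * a"
      by (rule solvable_mod_pow2_core) (use odd sum less 3 param in \<open>auto simp: ac_simps\<close>)
    finally show ?thesis by (simp only: m flip mult.commute[of c] mult.commute[of d] eq_commute[of \<gamma>])
  next
    case 4
    then have m: "?m = \<delta>" "\<delta> = \<beta> \<longleftrightarrow> \<alpha> = \<gamma>" using sum by auto
    have "?solvable \<longleftrightarrow> solvable_mod (2 ^ n) (2 ^ \<delta> * d) (2 ^ \<gamma> * c) (2 ^ \<beta> * b) (2 ^ \<alpha> * a)"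
      using solvable_mod_swap_rows solvable_mod_swap_columns by blast
    also have "\<dots> \<longleftrightarrow> \<delta> = \<beta> \<or> \<not> 2 ^ (\<delta> + 1) dvd d * a - c * b"
      by (rule solvable_mod_pow2_core) (use odd sum less 4 param in \<open>auto simp: ac_simps\<close>)
    finally show ?thesis by (simp only: m mult.commute[of c] mult.commute[of d])
  qed
qed

lemma invertible_mod_pow2_odd:
  assumes "n \<ge> 1" "invertible_or_zero_mod (2 ^ n) c" "\<not> [c = 0] (mod 2 ^ n)"
  shows "odd c"
proof -
  obtain d where "[c * d = 1] (mod 2 ^ n)"
    using assms by (auto simp: invertible_or_zero_mod_def)
  moreover have "(2::int) dvd 2 ^ n" using assms(1) by simp
  ultimately have "[c * d = 1] (mod 2)" by (rule cong_dvd_modulus)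
  then show ?thesis by (auto simp: cong_def)
qed

text \<open>
  On nonzero residues the power in question is the 2-adic valuation.
\<close>

lemma two_power_mod_eqI:
  fixes u :: int
  assumes "odd u" "v < n"
  shows "two_power_mod n (2 ^ v * u) = v"
  unfolding two_power_mod_def
proof (rule Least_equality)
  have "coprime u (2 ^ n)" using assms(1) by simp
  then have "invertible_or_zero_mod (2 ^ n) u"
    using cong_solve_coprime_int by (auto simp: invertible_or_zero_mod_def)
  then show "\<exists>\<nu>. invertible_or_zero_mod (2 ^ n) \<nu> \<and> [2 ^ v * \<nu> = 2 ^ v * u] (mod 2 ^ n)"
    by (intro exI[of _ u]) simp
next
  fix s
  assume "\<exists>\<nu>. invertible_or_zero_mod (2 ^ n) \<nu> \<and> [2 ^ s * \<nu> = 2 ^ v * u] (mod 2 ^ n)"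
  then obtain \<nu> where \<nu>: "invertible_or_zero_mod (2 ^ n) \<nu>"
    and "[2 ^ s * \<nu> = 2 ^ v * u] (mod 2 ^ n)" by blast
  then have dvd: "2 ^ n dvd 2 ^ v * u + 2 ^ s * (- \<nu>)"
    by (auto simp: cong_iff_dvd_diff dvd_diff_commute)
  have "\<not> [\<nu> = 0] (mod 2 ^ n)"
  proof
    assume "[\<nu> = 0] (mod 2 ^ n)"
    then have "2 ^ n dvd 2 ^ s * (- \<nu>)" by (simp add: cong_0_iff)
    with dvd have "2 ^ n dvd 2 ^ v * u" by (metis dvd_add_left_iff)
    then show False using pow2_dvd_odd_multiple_iff[OF assms(1)] assms(2) by simp
  qed
  then have "odd (- \<nu>)" using invertible_mod_pow2_odd[OF _ \<nu>] assms(2) by simp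
  from pow2_sum_exponents_eq[OF assms(1) this dvd assms(2)] show "v \<le> s" by simp
qed

text \<open>
  The zero residue has to be listed separately on the left because its power is \<open>0\<close> by
  convention, although it is divisible by every \<open>2\<^sup>k\<close> with \<open>k \<le> n\<close>.
\<close>

lemma two_power_mod_greater_iff:
  assumes "m < n"
  shows "two_power_mod n c > m \<or> [c = 0] (mod 2 ^ n) \<longleftrightarrow> 2 ^ (m + 1) dvd c"
proof (cases "[c = 0] (mod 2 ^ n)")
  case True
  moreover have "(2::int) ^ (m + 1) dvd 2 ^ n" using assms by (intro le_imp_power_dvd) simp
  ultimately have "2 ^ (m + 1) dvd c" unfolding cong_0_iff by (rule dvd_trans[rotated])
  with True show ?thesis by blast
next
  case False
  then have "c \<noteq> 0" by auto
  then obtain v u where vu: "c = 2 ^ v * u" "odd u" by (rule odd_part_int)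
  then have dvd: "2 ^ k dvd c \<longleftrightarrow> k \<le> v" for k
    using vu by (simp only: pow2_dvd_odd_multiple_iff)
  with False have "v < n" by (simp add: cong_0_iff)
  then have "two_power_mod n c = v" using vu two_power_mod_eqI by simp
  with False show ?thesis by (simp add: dvd Suc_le_eq del: power_Suc)
qed

lemma Min_matrix_2:
  fixes M :: "nat^2^2"
  shows "Min {M$i$k | i k. True} = min (min (M$1$1) (M$1$2)) (min (M$2$1) (M$2$2))"
proof -
  have "{M$i$k | i k. True} = (\<Union>i. \<Union>k. {M$i$k})"
    by blast
  also have "\<dots> = {M$1$1, M$1$2, M$2$1, M$2$2}"
    unfolding UNIV_2 by auto
  finally show ?thesis by (simp add: min.assoc)
qed

text \<open>
  All solvable cases except those of \<open>solvable_mod_pow2\<close> are cases in which both products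
  \<open>a\<^sub>1\<^sub>1 a\<^sub>2\<^sub>2\<close> and \<open>a\<^sub>1\<^sub>2 a\<^sub>2\<^sub>1\<close> vanish modulo \<open>2\<^sup>n\<close>; if one of them does, so does the other one, their sum
  being zero. The condition on \<open>det \<mu>\<close> concerns only its divisibility by \<open>2\<close> to the power
  \<open>1 + min \<aa>\<^sub>i\<^sub>j\<close>.
\<close>

proposition unsolvable_mod_pow2_iff:
  fixes a \<mu> :: "int^2^2"
  assumes coeff: "is_matrix_of_coefficients n a \<mu>"
    and param: "[a$1$1 * a$2$2 + a$1$2 * a$2$1 = 0] (mod 2 ^ n)"
  defines "\<aa> \<equiv> matrix_of_powers n a"
  shows "\<not> solvable_mod (2 ^ n) (a$1$1) (a$1$2) (a$2$1) (a$2$2) \<longleftrightarrow>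
     n \<ge> 1 \<and> (\<forall>i k. \<not> [\<mu>$i$k = 0] (mod 2 ^ n)) \<and> \<aa>$1$1 + \<aa>$2$2 < n \<and> \<aa>$1$1 \<noteq> \<aa>$2$1 \<and>
     (coefficient_matrix_power n \<mu> > Min {\<aa>$i$k | i k. True} \<or> [det \<mu> = 0] (mod 2 ^ n))"
    (is "\<not> ?solvable \<longleftrightarrow> ?R")
proof -
  have entry: "[a$i$k = 2 ^ (\<aa>$i$k) * \<mu>$i$k] (mod 2 ^ n)" for i k
    using coeff by (simp add: is_matrix_of_coefficients_def \<aa>_def cong_sym)
  have vanishing: ?solvable if "[a$1$1 * a$2$2 = 0] (mod 2 ^ n) \<or> [a$1$2 * a$2$1 = 0] (mod 2 ^ n)"
  proof (rule solvable_mod_of_vanishing_diagonals)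
    show "[a$1$1 * a$2$2 = 0] (mod int (2 ^ n))" "[a$1$2 * a$2$1 = 0] (mod int (2 ^ n))"
      using that param by (auto simp: cong_0_iff dvd_add_right_iff dvd_add_left_iff)
  qed
  consider (zero) "n = 0" | (coeff_zero) i k where "[\<mu>$i$k = 0] (mod 2 ^ n)"
    | (large) "\<aa>$1$1 + \<aa>$2$2 \<ge> n"
    | (small) "n \<ge> 1" "\<forall>i k. \<not> [\<mu>$i$k = 0] (mod 2 ^ n)" "\<aa>$1$1 + \<aa>$2$2 < n"
    by (meson less_one not_le)
  then show ?thesis
  proof cases
    case zero
    then have ?solvable by (simp add: solvable_mod_def)
    with zero show ?thesis by simp
  next
    case coeff_zero
    then have "[2 ^ (\<aa>$i$k) * \<mu>$i$k = 0] (mod 2 ^ n)" by (simp add: cong_0_iff)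
    with entry have "[a$i$k = 0] (mod 2 ^ n)" by (rule cong_trans)
    then have "2 ^ n dvd a$i$k" by (simp add: cong_0_iff)
    then have "[a$1$1 * a$2$2 = 0] (mod 2 ^ n) \<or> [a$1$2 * a$2$1 = 0] (mod 2 ^ n)"
      using exhaust_2[of i] exhaust_2[of k] by (auto simp: cong_0_iff)
    then have ?solvable by (rule vanishing)
    with coeff_zero show ?thesis by blast
  next
    case large
    then have "(2::int) ^ n dvd 2 ^ (\<aa>$1$1 + \<aa>$2$2)" by (rule le_imp_power_dvd)
    then have "2 ^ n dvd (2 ^ (\<aa>$1$1) * \<mu>$1$1) * (2 ^ (\<aa>$2$2) * \<mu>$2$2)"
      by (simp add: power_add mult_ac)
    then have "[a$1$1 * a$2$2 = 0] (mod 2 ^ n)"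
      by (intro cong_trans[OF cong_mult[OF entry[of 1 1] entry[of 2 2]]]) (simp only: cong_0_iff)
    then have ?solvable by (intro vanishing disjI1)
    with large show ?thesis by simp
  next
    case small
    have odd: "odd (\<mu>$i$k)" for i k
      using coeff small(1,2) invertible_mod_pow2_odd[of n "\<mu>$i$k"]
      by (simp add: is_matrix_of_coefficients_def)
    have "[a$1$1 * a$2$2 + a$1$2 * a$2$1 = (2 ^ (\<aa>$1$1) * \<mu>$1$1) * (2 ^ (\<aa>$2$2) * \<mu>$2$2) +
        (2 ^ (\<aa>$1$2) * \<mu>$1$2) * (2 ^ (\<aa>$2$1) * \<mu>$2$1)] (mod 2 ^ n)"
      by (intro cong_add cong_mult entry)
    from cong_trans[OF cong_sym[OF this] param]
    have param': "2 ^ n dvd 2 ^ (\<aa>$1$1 + \<aa>$2$2) * (\<mu>$1$1 * \<mu>$2$2) +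
        2 ^ (\<aa>$1$2 + \<aa>$2$1) * (\<mu>$1$2 * \<mu>$2$1)"
      unfolding cong_0_iff power_add by (simp only: mult.assoc mult.left_commute)
    have sum: "\<aa>$1$2 + \<aa>$2$1 = \<aa>$1$1 + \<aa>$2$2"
      by (rule pow2_sum_exponents_eq[OF _ _ param' small(3)]) (simp_all add: odd)
    have "?solvable \<longleftrightarrow> solvable_mod (2 ^ n) (2 ^ (\<aa>$1$1) * \<mu>$1$1) (2 ^ (\<aa>$1$2) * \<mu>$1$2)
        (2 ^ (\<aa>$2$1) * \<mu>$2$1) (2 ^ (\<aa>$2$2) * \<mu>$2$2)"
      using entry by (intro solvable_mod_cong) simp_all
    also have "\<dots> \<longleftrightarrow> \<aa>$1$1 = \<aa>$2$1 \<or> \<not> 2 ^ (Min {\<aa>$i$k | i k. True} + 1) dvd det \<mu>"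
      unfolding Min_matrix_2 det_2
      by (rule solvable_mod_pow2) (use odd sum small param' in \<open>auto simp: distrib_left\<close>)
    also have "2 ^ (Min {\<aa>$i$k | i k. True} + 1) dvd det \<mu> \<longleftrightarrow>
        coefficient_matrix_power n \<mu> > Min {\<aa>$i$k | i k. True} \<or> [det \<mu> = 0] (mod 2 ^ n)"
      unfolding coefficient_matrix_power_def
      by (rule two_power_mod_greater_iff[symmetric], unfold Min_matrix_2)
        (use small in simp)
    finally show ?thesis using small by blast
  qed
qed

section \<open>Generalised Taft algebras without a pair in involution\<close>

theorem theorem4p8:
  fixes n j \<tau> :: nat
    and q :: "'k::{alg_closed_field, field_char_0}"
    and a \<mu> :: "int^2^2"
    and \<aa> :: "nat^2^2"
    and sc :: "'k \<Rightarrow> 'h::ring_1 \<Rightarrow> 'h"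
    and \<Delta> :: "'h \<Rightarrow> ('h \<times> 'h) list"
    and \<epsilon> :: "'h \<Rightarrow> 'k"
    and S :: "'h \<Rightarrow> 'h"
    and g x y :: 'h
  assumes "odd j" and "2 ^ n * j \<ge> 2"
    and "primitive_root_of_unity (2 ^ n * j) q"
    and "parameter_matrix (2 ^ n * j) a"
    and "generalised_taft_algebra (2 ^ n * j) q a sc \<Delta> \<epsilon> S g x y"
    and "\<aa> = matrix_of_powers n a"
    and "is_matrix_of_coefficients n a \<mu>"
    and "\<tau> = coefficient_matrix_power n \<mu>"
  shows "(\<not> (\<exists>l \<beta>. pair_in_involution sc \<Delta> \<epsilon> S l \<beta>)) \<longleftrightarrow>
     (n \<ge> 1 \<and>
      (\<forall>i k. \<not> [\<mu>$i$k = 0] (mod 2 ^ n)) \<and>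
      \<aa>$1$1 + \<aa>$2$2 < n \<and>
      \<aa>$1$1 \<noteq> \<aa>$2$1 \<and>
      (\<tau> > Min {\<aa>$i$k | i k. True} \<or> [det \<mu> = 0] (mod 2 ^ n)))"
proof -
  interpret generalised_taft_algebra "2 ^ n * j" q a sc \<Delta> \<epsilon> S g x y by fact
  have "[a$1$1 * a$2$2 + a$1$2 * a$2$1 = 0] (mod int (2 ^ n * j))"
    using assms(4) by (simp add: parameter_matrix_def)
  then have param: "[a$1$1 * a$2$2 + a$1$2 * a$2$1 = 0] (mod 2 ^ n)"
    "[a$1$1 * a$2$2 + a$1$2 * a$2$1 = 0] (mod int j)"
    by (auto simp: cong_0_iff intro: dvd_mult_left dvd_mult_right)
  have "(\<exists>l \<beta>. pair_in_involution sc \<Delta> \<epsilon> S l \<beta>) \<longleftrightarrow>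
      solvable_mod (2 ^ n * j) (a$1$1) (a$1$2) (a$2$1) (a$2$2)"
    unfolding pair_in_involution_exists_iff solvable_mod_def ..
  also have "\<dots> \<longleftrightarrow> solvable_mod (2 ^ n) (a$1$1) (a$1$2) (a$2$1) (a$2$2)"
    using solvable_mod_coprime_product[of "2 ^ n" j] solvable_mod_odd[OF assms(1) param(2)]
      assms(1) by simp
  finally show ?thesis
    using unsolvable_mod_pow2_iff[OF assms(7) param(1)] by (simp only: assms(6,8))
qed

end
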